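(* Let $\mathbb{A}$ be a unital commutative associative algebra over $\mathbb{C}$ and let $\mathcal{V}(\mathbb{A})=Vir\otimes\mathbb{A}$ be the map Virasoro Lie conformal algebra associated to $\mathbb{A}$. Then: (1) $\mathcal{V}(\mathbb{A})$ is artinian. (2) If $\mathbb{A}$ is infinite dimensional, then $\mathcal{V}(\mathbb{A})$ does not have finite faithful modules.
   Context: Everything is over $\mathbb{C}$. A Lie conformal algebra $\mathcal{A}$ is a $\mathbb{C}[\partial]$-module with a $\mathbb{C}$-bilinear $\lambda$-bracket $[\cdot_\lambda\cdot]:\mathcal{A}\otimes\mathcal{A}\to\mathcal{A}[\lambda]$ such that $[\partial a_\lambda b]=-\lambda[a_\lambda b]$, $[a_\lambda\partial b]=(\partial+\lambda)[a_\lambda b]$, $[a_\lambda b]=-[b_{-\lambda-\partial}a]$, and $[a_\lambda[b_\mu c]]=[[a_\lambda b]_{\lambda+\mu}c]+[b_\mu[a_\lambda c]]$. An $\mathcal{A}$-module is a $\mathbb{C}[\partial]$-module $M$ with a $\mathbb{C}$-linear map $\mathcal{A}\otimes M\to M[\lambda]$, $a\otimes m\mapsto a_\lambda m$, such that $(\partial a)_\lambda m=-\lambda a_\lambda m$, $a_\lambda(\partial m)=(\partial+\lambda)a_\lambda m$, $a_\lambda(b_\mu m)=[a_\lambda b]_{\lambda+\mu}m+b_\mu(a_\lambda m)$. A submodule is a $\mathbb{C}[\partial]$-submodule $N$ with $a_\lambda N\subseteq N[\lambda]$ for all $a\in\mathcal{A}$; irreducible means having no submodules other than $0$ and itself. A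 module is finite if finitely generated over $\mathbb{C}[\partial]$, free if free over $\mathbb{C}[\partial]$, trivial if $a_\lambda m=0$ for all $a,m$, and faithful if no nonzero $a\in\mathcal{A}$ satisfies $a_\lambda m=0$ for all $m$. A Lie conformal algebra $\mathcal{A}$ is artinian if every finite non-trivial free $\mathcal{A}$-module has a non-trivial irreducible $\mathcal{A}$-submodule. $Vir=\mathbb{C}[\partial]L$ is the free rank one $\mathbb{C}[\partial]$-module with $[L_\lambda L]=(\partial+2\lambda)L$. $\mathcal{V}(\mathbb{A})=Vir\otimes\mathbb{A}$ has $\partial(L\otimes x)=(\partial L)\otimes x$ and, with $L_x:=L\otimes x$, $[{L_x}_\lambda L_y]=(\partial+2\lambda)L_{xy}$ for $x,y\in\mathbb{A}$. *)

theory Defs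
  imports "HOL-Computational_Algebra.Polynomial"
begin

section \<open>Polynomials in formal variables with coefficients in a module\<close>

text \<open>
  For an abelian group \<open>M\<close>, the group \<open>M[\<lambda>]\<close> is the type \<open>'m poly\<close>, and \<open>M[\<lambda>,\<mu>]\<close> is the type
  \<open>'m poly poly\<close>, where the inner variable is \<open>\<lambda>\<close> and the outer variable is \<open>\<mu>\<close>.

  If \<open>p = (\<Sum>i. c\<^sub>i \<lambda>^i)\<close> then \<open>poly_subst X f p = (\<Sum>i. X^i (f c\<^sub>i))\<close>: the variable is replaced by the
  operator \<open>X\<close>, acting from the left, and \<open>f\<close> embeds the coefficients into the target group.
\<close>

definition poly_subst :: "('b \<Rightarrow> 'b) \<Rightarrow> ('a \<Rightarrow> 'b) \<Rightarrow> 'a::zero poly \<Rightarrow> 'b::comm_monoid_add" where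
  "poly_subst X f p = (\<Sum>i\<le>degree p. (X ^^ i) (f (coeff p i)))"

abbreviation (input) var_times :: "'m::zero poly \<Rightarrow> 'm poly" where
  "var_times \<equiv> pCons 0"

definition lam_times :: "'m::zero poly poly \<Rightarrow> 'm poly poly" where
  "lam_times q = map_poly (pCons 0) q"

definition mu_times :: "'m::zero poly poly \<Rightarrow> 'm poly poly" where
  "mu_times q = pCons 0 q"

text \<open>\<open>p(\<lambda>) \<mapsto> p(\<mu>)\<close> and \<open>p(\<lambda>) \<mapsto> p(\<lambda> + \<mu>)\<close>, as maps \<open>M[\<lambda>] \<rightarrow> M[\<lambda>,\<mu>]\<close>.\<close>

definition at_mu :: "'m::zero poly \<Rightarrow> 'm poly poly" where
  "at_mu p = map_poly (\<lambda>c. [:c:]) p"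

definition at_lam_plus_mu :: "'m::ab_group_add poly \<Rightarrow> 'm poly poly" where
  "at_lam_plus_mu p = poly_subst (\<lambda>q. lam_times q + mu_times q) (\<lambda>c. [:[:c:]:]) p"


section \<open>Lie conformal algebras and their modules\<close>

text \<open>
  A \<open>\<complex>[\<partial>]\<close>-module is an instance of \<^locale>\<open>module\<close> over the ring \<^typ>\<open>complex poly\<close>;
  \<open>\<partial>\<close> is the action of \<open>[:0, 1:]\<close> and a scalar \<open>c\<close> acts as \<open>[:c:]\<close>.
\<close>

abbreviation (input) del :: "(complex poly \<Rightarrow> 'm \<Rightarrow> 'm) \<Rightarrow> 'm \<Rightarrow> 'm" where
  "del s \<equiv> s [:0, 1:]"

definition cscale :: "(complex poly \<Rightarrow> 'm \<Rightarrow> 'm) \<Rightarrow> complex \<Rightarrow> 'm \<Rightarrow> 'm" where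
  "cscale s c m = s [:c:] m"

definition cscale_poly :: "(complex poly \<Rightarrow> 'm::zero \<Rightarrow> 'm) \<Rightarrow> complex \<Rightarrow> 'm poly \<Rightarrow> 'm poly" where
  "cscale_poly s c p = map_poly (cscale s c) p"

text \<open>
  The next three terms are \<open>a\<^sub>\<lambda>(b\<^sub>\<mu> m)\<close>, \<open>b\<^sub>\<mu>(a\<^sub>\<lambda> m)\<close> and \<open>[a\<^sub>\<lambda> b]\<^bsub>\<lambda>+\<mu>\<^esub> m\<close>. Here \<open>act a m\<close> stands
  for \<open>a\<^sub>\<lambda> m\<close> and \<open>br a b\<close> for \<open>[a\<^sub>\<lambda> b]\<close>.
\<close>

definition act_lam_mu :: "('l \<Rightarrow> 'm \<Rightarrow> 'm::zero poly) \<Rightarrow> 'l \<Rightarrow> 'l \<Rightarrow> 'm \<Rightarrow> 'm poly poly" where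
  "act_lam_mu act a b m = map_poly (act a) (act b m)"

definition act_mu_lam ::
  "('l \<Rightarrow> 'm \<Rightarrow> 'm::ab_group_add poly) \<Rightarrow> 'l \<Rightarrow> 'l \<Rightarrow> 'm \<Rightarrow> 'm poly poly" where
  "act_mu_lam act b a m = poly_subst lam_times (\<lambda>n. at_mu (act b n)) (act a m)"

definition act_bracket ::
  "('l \<Rightarrow> 'l \<Rightarrow> 'l::zero poly) \<Rightarrow> ('l \<Rightarrow> 'm \<Rightarrow> 'm::ab_group_add poly) \<Rightarrow>
    'l \<Rightarrow> 'l \<Rightarrow> 'm \<Rightarrow> 'm poly poly" where
  "act_bracket br act a b m = poly_subst lam_times (\<lambda>e. at_lam_plus_mu (act e m)) (br a b)"

locale lie_conformal_algebra = module sA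
  for sA :: "complex poly \<Rightarrow> 'l::ab_group_add \<Rightarrow> 'l" +
  fixes br :: "'l \<Rightarrow> 'l \<Rightarrow> 'l poly"
  assumes br_linear_right: "Vector_Spaces.linear (cscale sA) (cscale_poly sA) (br a)"
    and br_linear_left: "Vector_Spaces.linear (cscale sA) (cscale_poly sA) (\<lambda>a. br a b)"
    and br_del_left: "br (del sA a) b = - var_times (br a b)"
    and br_del_right: "br a (del sA b) = map_poly (del sA) (br a b) + var_times (br a b)"
    and br_skew: "br a b =
          - poly_subst (\<lambda>q. - var_times q - map_poly (del sA) q) (\<lambda>c. [:c:]) (br b a)"
    and br_jacobi: "act_lam_mu br a b c = act_bracket br br a b c + act_mu_lam br b a c"

locale conformal_module = lie_conformal_algebra sA br + M: module sM
  for sA :: "complex poly \<Rightarrow> 'l::ab_group_add \<Rightarrow> 'l" and br :: "'l \<Rightarrow> 'l \<Rightarrow> 'l poly"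
    and sM :: "complex poly \<Rightarrow> 'm::ab_group_add \<Rightarrow> 'm" +
  fixes act :: "'l \<Rightarrow> 'm \<Rightarrow> 'm poly"
  assumes act_linear_right: "Vector_Spaces.linear (cscale sM) (cscale_poly sM) (act a)"
    and act_linear_left: "Vector_Spaces.linear (cscale sA) (cscale_poly sM) (\<lambda>a. act a m)"
    and act_del_left: "act (del sA a) m = - var_times (act a m)"
    and act_del_right: "act a (del sM m) = map_poly (del sM) (act a m) + var_times (act a m)"
    and act_jacobi: "act_lam_mu act a b m = act_bracket br act a b m + act_mu_lam act b a m"

definition finite_module :: "('r::comm_ring_1 \<Rightarrow> 'm::ab_group_add \<Rightarrow> 'm) \<Rightarrow> bool" where
  "finite_module s \<longleftrightarrow> (\<exists>B. finite B \<and> module.span s B = UNIV)"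

definition free_module :: "('r::comm_ring_1 \<Rightarrow> 'm::ab_group_add \<Rightarrow> 'm) \<Rightarrow> bool" where
  "free_module s \<longleftrightarrow> (\<exists>B. \<not> module.dependent s B \<and> module.span s B = UNIV)"

definition conformal_submodule ::
  "(complex poly \<Rightarrow> 'm::ab_group_add \<Rightarrow> 'm) \<Rightarrow> ('l \<Rightarrow> 'm \<Rightarrow> 'm poly) \<Rightarrow> 'm set \<Rightarrow> bool" where
  "conformal_submodule sM act N \<longleftrightarrow>
     module.subspace sM N \<and> (\<forall>a. \<forall>n\<in>N. \<forall>i. coeff (act a n) i \<in> N)"

text \<open>
  The submodules of a submodule \<open>N\<close> of \<open>M\<close> are the submodules of \<open>M\<close> contained in \<open>N\<close>.
  The zero module is irreducible in this sense, but it is trivial.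
\<close>

definition irreducible_submodule ::
  "(complex poly \<Rightarrow> 'm::ab_group_add \<Rightarrow> 'm) \<Rightarrow> ('l \<Rightarrow> 'm \<Rightarrow> 'm poly) \<Rightarrow> 'm set \<Rightarrow> bool" where
  "irreducible_submodule sM act N \<longleftrightarrow>
     conformal_submodule sM act N \<and>
     (\<forall>N'. conformal_submodule sM act N' \<and> N' \<subseteq> N \<longrightarrow> N' = {0} \<or> N' = N)"

definition trivial_on :: "('l \<Rightarrow> 'm::zero \<Rightarrow> 'm poly) \<Rightarrow> 'm set \<Rightarrow> bool" where
  "trivial_on act N \<longleftrightarrow> (\<forall>a. \<forall>m\<in>N. act a m = 0)"

definition faithful :: "('l::zero \<Rightarrow> 'm::zero \<Rightarrow> 'm poly) \<Rightarrow> bool" where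
  "faithful act \<longleftrightarrow> \<not> (\<exists>a. a \<noteq> 0 \<and> (\<forall>m. act a m = 0))"

text \<open>
  The argument of type \<open>'m itself\<close> names the type on which the modules live. A theorem stating
  \<open>artinian sA br TYPE('m)\<close> for a type variable \<open>'m\<close> covers all modules.
\<close>

definition artinian ::
  "(complex poly \<Rightarrow> 'l::ab_group_add \<Rightarrow> 'l) \<Rightarrow> ('l \<Rightarrow> 'l \<Rightarrow> 'l poly) \<Rightarrow>
    'm::ab_group_add itself \<Rightarrow> bool" where
  "artinian sA br (_ :: 'm itself) \<longleftrightarrow>
     (\<forall>(sM :: complex poly \<Rightarrow> 'm \<Rightarrow> 'm) act.
        conformal_module sA br sM act \<and> finite_module sM \<and> free_module sM \<and>
        \<not> trivial_on act UNIV \<longrightarrow>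
        (\<exists>N. irreducible_submodule sM act N \<and> \<not> trivial_on act N))"


section \<open>The Virasoro and map Virasoro Lie conformal algebras\<close>

text \<open>
  \<open>Vir = \<complex>[\<partial>]L\<close> is the type \<^typ>\<open>complex poly\<close>, with \<open>p\<close> standing for \<open>p(\<partial>)L\<close>. Elements of
  \<open>Vir[\<lambda>]\<close> have type \<^typ>\<open>complex poly poly\<close>, with inner variable \<open>\<partial>\<close> and outer variable \<open>\<lambda>\<close>.
  By sesquilinearity, \<open>[p(\<partial>)L\<^sub>\<lambda> q(\<partial>)L] = p(-\<lambda>) q(\<partial>+\<lambda>) (\<partial>+2\<lambda>) L\<close>.
\<close>

definition vir_bracket :: "complex poly \<Rightarrow> complex poly \<Rightarrow> complex poly poly" where
  "vir_bracket p q =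
     poly (map_poly (\<lambda>c. [:[:c:]:]) p) [:0, - 1:] *
     poly (map_poly (\<lambda>c. [:[:c:]:]) q) [:[:0, 1:], 1:] * [:[:0, 1:], 2:]"

text \<open>
  A unital commutative associative \<open>\<complex>\<close>-algebra. The sort is used instead of \<^class>\<open>comm_ring_1\<close>
  so that the zero algebra is not excluded.
\<close>

locale unital_comm_algebra = vector_space sc
  for sc :: "complex \<Rightarrow> 'a::{comm_ring, comm_monoid_mult} \<Rightarrow> 'a" +
  assumes scale_mult_left: "sc c (x * y) = sc c x * y"

text \<open>
  The tensor product \<open>Vir \<otimes> A = \<complex>[\<partial>]L \<otimes> A\<close> is \<open>A[\<partial>]\<close>, i.e. the type \<open>'a poly\<close>, where
  \<open>p(\<partial>)L \<otimes> x\<close> is \<open>p\<close> with coefficients multiplied by \<open>x\<close>. A bilinear map \<open>h\<close> on \<open>Vir \<times> A\<close>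
  induces \<open>tensor_lift h\<close> on \<open>Vir \<otimes> A\<close>; the universal property is proved below.
\<close>

definition tensor :: "(complex \<Rightarrow> 'a \<Rightarrow> 'a) \<Rightarrow> complex poly \<Rightarrow> 'a::zero \<Rightarrow> 'a poly" where
  "tensor sc p x = map_poly (\<lambda>c. sc c x) p"

definition tensor_lift :: "(complex poly \<Rightarrow> 'a \<Rightarrow> 'w) \<Rightarrow> 'a::zero poly \<Rightarrow> 'w::comm_monoid_add" where
  "tensor_lift h f = (\<Sum>i\<le>degree f. h (monom 1 i) (coeff f i))"

definition map_vir_scale ::
  "(complex \<Rightarrow> 'a \<Rightarrow> 'a) \<Rightarrow> complex poly \<Rightarrow> 'a::ab_group_add poly \<Rightarrow> 'a poly" where
  "map_vir_scale sc r = tensor_lift (\<lambda>p x. tensor sc (r * p) x)"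

text \<open>The bilinear extension of \<open>[(u \<otimes> x)\<^sub>\<lambda> (v \<otimes> y)] = [u\<^sub>\<lambda> v] \<otimes> xy\<close>.\<close>

definition map_vir_bracket ::
  "(complex \<Rightarrow> 'a \<Rightarrow> 'a) \<Rightarrow> 'a poly \<Rightarrow> 'a::comm_ring poly \<Rightarrow> 'a poly poly" where
  "map_vir_bracket sc f g =
     tensor_lift (\<lambda>u x. tensor_lift (\<lambda>v y.
       map_poly (\<lambda>r. tensor sc r (x * y)) (vir_bracket u v)) g) f"


subsection \<open>Additivity\<close>

lemma map_poly_additive:
  assumes "additive f" shows "additive (map_poly f)"
proof
  interpret additive f by fact
  show "map_poly f (p + q) = map_poly f p + map_poly f q" for p q
    by (rule poly_eqI) (simp add: coeff_map_poly zero add)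
qed

lemma additive_funpow:
  fixes X :: "'a::ab_group_add \<Rightarrow> 'a"
  shows "additive X \<Longrightarrow> additive (X ^^ i)"
  by (induction i) (auto simp: additive_def)

lemma poly_subst_bound:
  fixes X :: "'b::ab_group_add \<Rightarrow> 'b" and f :: "'a::ab_group_add \<Rightarrow> 'b"
  assumes "additive X" "additive f" "degree p \<le> n"
  shows "poly_subst X f p = (\<Sum>i\<le>n. (X ^^ i) (f (coeff p i)))"
proof -
  have "(X ^^ i) (f (coeff p i)) = 0" if "i > degree p" for i
    using that additive.zero[OF additive_funpow[OF assms(1)]] additive.zero[OF assms(2)]
    by (simp add: coeff_eq_0)
  then show ?thesis
    unfolding poly_subst_def using assms(3)
    by (intro sum.mono_neutral_left) auto
qed

lemma poly_subst_additive:
  fixes X :: "'b::ab_group_add \<Rightarrow> 'b" and f :: "'a::ab_group_add \<Rightarrow> 'b"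
  assumes "additive X" "additive f"
  shows "additive (poly_subst X f)"
proof
  fix p q :: "'a poly"
  define n where "n = max (degree p) (degree q)"
  have b: "degree p \<le> n" "degree q \<le> n" "degree (p + q) \<le> n"
    by (auto simp: n_def degree_add_le_max)
  show "poly_subst X f (p + q) = poly_subst X f p + poly_subst X f q"
    unfolding b[THEN poly_subst_bound[OF assms]]
    by (simp add: additive.add[OF assms(2)] additive.add[OF additive_funpow[OF assms(1)]]
        sum.distrib)
qed

lemma poly_subst_map:
  fixes X :: "'b::ab_group_add \<Rightarrow> 'b" and f :: "'a::ab_group_add \<Rightarrow> 'b"
    and X' :: "'d::ab_group_add \<Rightarrow> 'd" and f' :: "'c::ab_group_add \<Rightarrow> 'd"
  assumes "additive G" "additive g" "additive X'" "additive f'"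
    and X: "\<And>q. G (X q) = X' (G q)" and f: "\<And>c. G (f c) = f' (g c)"
  shows "G (poly_subst X f p) = poly_subst X' f' (map_poly g p)"
proof -
  have pow: "G ((X ^^ i) q) = (X' ^^ i) (G q)" for i q
    by (induction i) (auto simp: X)
  have "degree (map_poly g p) \<le> degree p"
    by (rule map_poly_degree_leq)
  from poly_subst_bound[OF assms(3,4) this] show ?thesis
    unfolding poly_subst_def
    by (simp add: additive.sum[OF assms(1)] pow f coeff_map_poly additive.zero[OF assms(2)])
qed

lemma poly_subst_additive_fun:
  fixes X :: "'b::ab_group_add \<Rightarrow> 'b"
  assumes "additive X" "\<And>c. additive (\<lambda>x. f x c)"
  shows "additive (\<lambda>x. poly_subst X (f x) p)"
  unfolding poly_subst_def
  by standard (simp add: additive.add[OF assms(2)] additive.add[OF additive_funpow[OF assms(1)]]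
        sum.distrib)

lemma map_poly_additive_fun:
  assumes "\<And>x. additive (f x)" "\<And>c. additive (\<lambda>x. f x c)"
  shows "additive (\<lambda>x. map_poly (f x) p)"
  using assms
  by unfold_locales
    (auto intro!: poly_eqI simp: coeff_map_poly additive.zero[OF assms(1)] additive.add[OF assms(2)])

lemma additive_comp: "additive f \<Longrightarrow> additive g \<Longrightarrow> additive (\<lambda>x. f (g x))"
  by (simp add: additive_def)

lemma additive_pCons0: "additive (pCons (0::'a::ab_group_add))"
  by (simp add: additive_def)

lemma additive_const_poly: "additive (\<lambda>c::'a::ab_group_add. [:c:])"
  "additive (\<lambda>c::'a::ab_group_add. [:[:c:]:])"
  by (simp_all add: additive_def)

lemma additive_lam_times: "additive (lam_times :: 'a::ab_group_add poly poly \<Rightarrow> _)"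
  unfolding lam_times_def[abs_def] by (rule map_poly_additive[OF additive_pCons0])

lemma additive_lam_mu:
  "additive (\<lambda>q::'a::ab_group_add poly poly. lam_times q + mu_times q)"
proof
  have "mu_times (p + q) = mu_times p + mu_times q" for p q :: "'a poly poly"
    by (simp add: mu_times_def)
  then show "lam_times (p + q) + mu_times (p + q) = lam_times p + mu_times p + (lam_times q + mu_times q)"
    for p q :: "'a poly poly"
    by (simp add: additive.add[OF additive_lam_times] algebra_simps)
qed

lemma additive_at_mu: "additive (at_mu :: 'a::ab_group_add poly \<Rightarrow> _)"
  unfolding at_mu_def[abs_def] by (rule map_poly_additive[OF additive_const_poly(1)])

lemma additive_at_lam_plus_mu: "additive (at_lam_plus_mu :: 'a::ab_group_add poly \<Rightarrow> _)"
  unfolding at_lam_plus_mu_def[abs_def]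
  by (rule poly_subst_additive[OF additive_lam_mu additive_const_poly(2)])

context
  fixes br :: "'l::ab_group_add \<Rightarrow> 'l \<Rightarrow> 'l poly" and act :: "'l \<Rightarrow> 'm::ab_group_add \<Rightarrow> 'm poly"
  assumes br: "\<And>a. additive (br a)" "\<And>b. additive (\<lambda>a. br a b)"
    and act: "\<And>a. additive (act a)" "\<And>b. additive (\<lambda>a. act a b)"
begin

lemma additive_act_lam_mu:
  "additive (act_lam_mu act a b)" "additive (\<lambda>b. act_lam_mu act a b c)"
  "additive (\<lambda>a. act_lam_mu act a b c)"
  unfolding act_lam_mu_def[abs_def]
  by (rule additive_comp[OF map_poly_additive[OF act(1)] act(1)]
      additive_comp[OF map_poly_additive[OF act(1)] act(2)]
      map_poly_additive_fun[OF act])+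

lemma additive_act_mu_lam:
  "additive (act_mu_lam act b a)" "additive (\<lambda>b. act_mu_lam act b a c)"
  "additive (\<lambda>a. act_mu_lam act b a c)"
proof -
  have *: "additive (\<lambda>n. at_mu (act b n))" "additive (\<lambda>b. at_mu (act b n))" for b n
    by (rule additive_comp[OF additive_at_mu act(1)] additive_comp[OF additive_at_mu act(2)])+
  note ** = poly_subst_additive[OF additive_lam_times *(1)]
  show "additive (act_mu_lam act b a)"
    unfolding act_mu_lam_def[abs_def] by (rule additive_comp[OF ** act(1)])
  show "additive (\<lambda>b. act_mu_lam act b a c)"
    unfolding act_mu_lam_def[abs_def] by (rule poly_subst_additive_fun[OF additive_lam_times *(2)])
  show "additive (\<lambda>a. act_mu_lam act b a c)"
    unfolding act_mu_lam_def[abs_def] by (rule additive_comp[OF ** act(2)])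
qed

lemma additive_act_bracket:
  "additive (act_bracket br act a b)" "additive (\<lambda>b. act_bracket br act a b c)"
  "additive (\<lambda>a. act_bracket br act a b c)"
proof -
  have *: "additive (\<lambda>n. at_lam_plus_mu (act b n))" "additive (\<lambda>b. at_lam_plus_mu (act b n))" for b n
    by (rule additive_comp[OF additive_at_lam_plus_mu act(1)]
        additive_comp[OF additive_at_lam_plus_mu act(2)])+
  note ** = poly_subst_additive[OF additive_lam_times *(2)]
  show "additive (act_bracket br act a b)"
    unfolding act_bracket_def[abs_def] by (rule poly_subst_additive_fun[OF additive_lam_times *(1)])
  show "additive (\<lambda>b. act_bracket br act a b c)"
    unfolding act_bracket_def[abs_def] by (rule additive_comp[OF ** br(1)])
  show "additive (\<lambda>a. act_bracket br act a b c)"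
    unfolding act_bracket_def[abs_def] by (rule additive_comp[OF ** br(2)])
qed

end


subsection \<open>The Virasoro bracket\<close>

definition eval2 :: "complex poly poly \<Rightarrow> complex \<Rightarrow> complex \<Rightarrow> complex" where
  "eval2 F d l = poly (poly F [:l:]) d"

definition eval3 :: "complex poly poly poly \<Rightarrow> complex \<Rightarrow> complex \<Rightarrow> complex \<Rightarrow> complex" where
  "eval3 F d l m = eval2 (poly F [:[:m:]:]) d l"

lemma infinite_constants: "infinite (range (\<lambda>c::complex. [:c:]))"
  "infinite (range (\<lambda>c::complex. [:[:c:]:]))"
  by (simp_all add: finite_image_iff inj_def infinite_UNIV_char_0)

lemma eval2_ext:
  assumes "\<And>d l. eval2 F d l = eval2 G d l" shows "F = G"
proof -
  have "poly (F - G) [:l:] = 0" for l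
    using assms by (intro poly_eq_poly_eq_iff[THEN iffD1] ext) (simp add: eval2_def)
  then have "range (\<lambda>c::complex. [:c:]) \<subseteq> {x. poly (F - G) x = 0}" by auto
  then have "F - G = 0"
    using poly_roots_finite infinite_constants(1) finite_subset by blast
  then show ?thesis by simp
qed

lemma eval3_ext:
  assumes "\<And>d l m. eval3 F d l m = eval3 G d l m" shows "F = G"
proof -
  have "poly (F - G) [:[:m:]:] = 0" for m
    by (rule eval2_ext) (use assms in \<open>simp add: eval3_def eval2_def\<close>)
  then have "range (\<lambda>c::complex. [:[:c:]:]) \<subseteq> {x. poly (F - G) x = 0}" by auto
  then have "F - G = 0"
    using poly_roots_finite infinite_constants(2) finite_subset by blast
  then show ?thesis by simp
qed

lemma eval2_simps:
  "eval2 0 d l = 0" "eval2 (F + G) d l = eval2 F d l + eval2 G d l"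
  "eval2 (F - G) d l = eval2 F d l - eval2 G d l" "eval2 (- F) d l = - eval2 F d l"
  "eval2 (F * G) d l = eval2 F d l * eval2 G d l" "eval2 (pCons p F) d l = poly p d + l * eval2 F d l"
  "eval2 (sum H A) d l = (\<Sum>i\<in>A. eval2 (H i) d l)"
  by (simp_all add: eval2_def poly_sum)

lemma eval3_simps:
  "eval3 0 d l m = 0" "eval3 (F + G) d l m = eval3 F d l m + eval3 G d l m"
  "eval3 (F * G) d l m = eval3 F d l m * eval3 G d l m"
  "eval3 (pCons p F) d l m = eval2 p d l + m * eval3 F d l m"
  "eval3 (sum H A) d l m = (\<Sum>i\<in>A. eval3 (H i) d l m)"
  by (simp_all add: eval3_def eval2_simps poly_sum eval2_def)

lemma eval2_altdef: "eval2 F d l = (\<Sum>i\<le>degree F. l ^ i * poly (coeff F i) d)"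
  by (simp add: eval2_def poly_altdef[of F] poly_sum mult.commute)

lemma eval3_altdef: "eval3 F d l m = (\<Sum>i\<le>degree F. m ^ i * eval2 (coeff F i) d l)"
  by (simp add: eval3_def poly_altdef[of F] eval2_def poly_sum mult.commute)

lemma eval2_bound: "degree F \<le> n \<Longrightarrow> eval2 F d l = (\<Sum>i\<le>n. l ^ i * poly (coeff F i) d)"
  unfolding eval2_altdef by (intro sum.mono_neutral_left) (auto simp: coeff_eq_0)

lemma eval3_bound: "degree F \<le> n \<Longrightarrow> eval3 F d l m = (\<Sum>i\<le>n. m ^ i * eval2 (coeff F i) d l)"
  unfolding eval3_altdef by (intro sum.mono_neutral_left) (auto simp: coeff_eq_0 eval2_simps)

lemma eval2_lift: "poly (poly (poly (map_poly (\<lambda>c. [:[:c:]:]) p) x) [:l:]) d = poly p (eval2 x d l)"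
  by (induction p) (auto simp: map_poly_pCons eval2_def)

lemma eval2_vir:
  "eval2 (vir_bracket p q) d l = poly p (- l) * poly q (d + l) * (d + 2 * l)"
proof -
  have "eval2 (poly (map_poly (\<lambda>c. [:[:c:]:]) p) x) d l = poly p (eval2 x d l)" for p x
    using eval2_lift by (simp add: eval2_def)
  then show ?thesis
    by (simp add: vir_bracket_def eval2_simps) (simp add: eval2_def numeral_poly algebra_simps)
qed

lemma eval2_map:
  assumes "\<And>c. poly (h c) d = a * poly c d'" "h 0 = 0"
  shows "eval2 (map_poly h F) d l = a * eval2 F d' l"
  unfolding eval2_bound[OF map_poly_degree_leq] eval2_altdef[of F]
  by (simp add: coeff_map_poly assms sum_distrib_left mult_ac)

lemma eval3_map:
  assumes "\<And>c. eval2 (h c) d l = a * poly c d'" "h 0 = 0"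
  shows "eval3 (map_poly h F) d l m = a * eval2 F d' m"
  unfolding eval3_bound[OF map_poly_degree_leq] eval2_altdef[of F]
  by (simp add: coeff_map_poly assms sum_distrib_left mult_ac)

lemma eval3_map2:
  assumes "\<And>c. eval2 (h c) d l = a * eval2 c d l" "h 0 = 0"
  shows "eval3 (map_poly h F) d l m = a * eval3 F d l m"
  unfolding eval3_bound[OF map_poly_degree_leq] eval3_altdef[of F]
  by (simp add: coeff_map_poly assms sum_distrib_left mult_ac)

lemma eval3_subst:
  assumes "\<And>q. eval3 (X q) d l m = x * eval3 q d l m"
    and "\<And>c. eval3 (f c) d l m = a * poly c d'"
  shows "eval3 (poly_subst X f p) d l m = a * eval2 p d' x"
proof -
  have "eval3 ((X ^^ i) q) d l m = x ^ i * eval3 q d l m" for i q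
    by (induction i) (auto simp: assms)
  then show ?thesis
    by (simp add: poly_subst_def eval3_simps assms eval2_altdef sum_distrib_left mult_ac)
qed

lemma eval3_lam: "eval3 (lam_times q) d l m = l * eval3 q d l m"
  unfolding lam_times_def by (rule eval3_map2) (simp_all add: eval2_simps)

lemma eval3_mu: "eval3 (mu_times q) d l m = m * eval3 q d l m"
  by (simp add: mu_times_def eval3_simps eval2_simps)

lemma eval3_at_mu: "eval3 (at_mu q) d l m = eval2 q d m"
  unfolding at_mu_def using eval3_map[where a = 1 and h = "\<lambda>c. [:c:]" and d' = d]
  by (simp add: eval2_simps)

lemma eval3_at_lam_plus_mu: "eval3 (at_lam_plus_mu q) d l m = eval2 q d (l + m)"
  unfolding at_lam_plus_mu_def
  by (subst eval3_subst[where x = "l + m" and a = 1 and d' = d])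
    (simp_all add: eval3_simps eval2_simps eval3_lam eval3_mu algebra_simps)

lemma additive_vir: "additive (vir_bracket p)" "additive (\<lambda>p. vir_bracket p q)"
  by (unfold_locales, rule eval2_ext, simp add: eval2_simps eval2_vir algebra_simps)+

lemma vir_zero [simp]: "vir_bracket p 0 = 0" "vir_bracket 0 p = 0"
  using additive.zero[OF additive_vir(1)] additive.zero[OF additive_vir(2)] by auto

lemma vir_jacobi:
  "act_lam_mu vir_bracket a b c =
     act_bracket vir_bracket vir_bracket a b c + act_mu_lam vir_bracket b a c"
proof (rule eval3_ext)
  fix d l m
  have 1: "eval3 (act_lam_mu vir_bracket a b c) d l m =
      (poly a (- l) * (d + 2 * l)) * (poly b (- m) * poly c (d + l + m) * (d + l + 2 * m))"
    unfolding act_lam_mu_def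
    by (subst eval3_map[where a = "poly a (- l) * (d + 2 * l)" and d' = "d + l"])
      (simp_all add: eval2_vir)
  have 2: "eval3 (act_bracket vir_bracket vir_bracket a b c) d l m =
      (poly c (d + (l + m)) * (d + 2 * (l + m))) *
      (poly a (- l) * poly b (- (l + m) + l) * (- (l + m) + 2 * l))"
    unfolding act_bracket_def
    by (subst eval3_subst[where x = l and a = "poly c (d + (l + m)) * (d + 2 * (l + m))"
            and d' = "- (l + m)"])
      (simp_all add: eval3_lam eval3_at_lam_plus_mu eval2_vir)
  have 3: "eval3 (act_mu_lam vir_bracket b a c) d l m =
      (poly b (- m) * (d + 2 * m)) * (poly a (- l) * poly c (d + m + l) * (d + m + 2 * l))"
    unfolding act_mu_lam_def
    by (subst eval3_subst[where x = l and a = "poly b (- m) * (d + 2 * m)" and d' = "d + m"])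
      (simp_all add: eval3_lam eval3_at_mu eval2_vir)
  show "eval3 (act_lam_mu vir_bracket a b c) d l m =
     eval3 (act_bracket vir_bracket vir_bracket a b c + act_mu_lam vir_bracket b a c) d l m"
    unfolding eval3_simps 1 2 3 by (simp add: algebra_simps)
qed

lemma vir_skew:
  "vir_bracket a b = - poly_subst (\<lambda>q. - var_times q - map_poly (\<lambda>p. [:0, 1:] * p) q)
     (\<lambda>c. [:c:]) (vir_bracket b a)"
proof (rule eval2_ext)
  fix d l
  define X where "X = (\<lambda>q. - var_times q - map_poly (\<lambda>p::complex poly. [:0, 1:] * p) q)"
  have X: "eval2 (X q) d l = (- l - d) * eval2 q d l" for q
    unfolding X_def by (simp add: eval2_simps eval2_map[where a = d and d' = d] algebra_simps)
  have "eval2 ((X ^^ i) q) d l = (- l - d) ^ i * eval2 q d l" for i q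
    by (induction i) (auto simp: X)
  then have "eval2 (poly_subst X (\<lambda>c. [:c:]) p) d l = eval2 p d (- l - d)" for p
    by (simp add: poly_subst_def eval2_simps eval2_altdef[of p])
  then show "eval2 (vir_bracket a b) d l = eval2 (- poly_subst X (\<lambda>c. [:c:]) (vir_bracket b a)) d l"
    by (simp add: eval2_simps eval2_vir algebra_simps)
qed

lemma vir_del_left: "vir_bracket ([:0, 1:] * a) b = - var_times (vir_bracket a b)"
  by (rule eval2_ext) (simp add: eval2_simps eval2_vir algebra_simps)

lemma vir_del_right:
  "vir_bracket a ([:0, 1:] * b) =
     map_poly (\<lambda>p. [:0, 1:] * p) (vir_bracket a b) + var_times (vir_bracket a b)"
  by (rule eval2_ext)
    (simp add: eval2_simps eval2_vir eval2_map[where a = d and d' = d for d] algebra_simps)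

lemma vir_smult:
  "vir_bracket (smult c a) b = map_poly (smult c) (vir_bracket a b)"
  "vir_bracket a (smult c b) = map_poly (smult c) (vir_bracket a b)"
proof -
  have "eval2 (map_poly (smult c) q) d l = c * eval2 q d l" for q d l
    by (rule eval2_map) simp_all
  then show "vir_bracket (smult c a) b = map_poly (smult c) (vir_bracket a b)"
    "vir_bracket a (smult c b) = map_poly (smult c) (vir_bracket a b)"
    by (auto intro!: eval2_ext simp: eval2_vir)
qed

lemma linear_iff_vs:
  "vector_space s1 \<Longrightarrow> vector_space s2 \<Longrightarrow> additive f \<Longrightarrow> (\<And>c x. f (s1 c x) = s2 c (f x)) \<Longrightarrow>
    Vector_Spaces.linear s1 s2 f"
  by (simp add: Vector_Spaces.linear_iff additive_def)

lemma vector_space_cscale: "module s \<Longrightarrow> vector_space (cscale s)"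
proof -
  assume "module s"
  then interpret module s .
  show ?thesis
    by unfold_locales
      (auto simp: cscale_def scale_right_distrib scale_left_distrib[symmetric] one_pCons[symmetric]
        mult.commute)
qed

lemma vector_space_cscale_poly: "module s \<Longrightarrow> vector_space (cscale_poly s)"
proof -
  assume "module s"
  then interpret vector_space "cscale s" by (rule vector_space_cscale)
  show ?thesis
    by unfold_locales
      (auto simp: cscale_poly_def coeff_map_poly scale_right_distrib scale_left_distrib
        intro!: poly_eqI)
qed

theorem virasoro_lie_conformal_algebra: "lie_conformal_algebra (*) vir_bracket"
proof -
  have m: "module ((*) :: complex poly \<Rightarrow> _)" by unfold_locales (auto simp: algebra_simps)
  have c: "cscale (*) = (smult :: complex \<Rightarrow> _)" by (intro ext) (simp add: cscale_def)
  have p: "cscale_poly (*) s q = map_poly (smult s) q" for s q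
    by (simp add: cscale_poly_def c)
  show ?thesis
    by (intro lie_conformal_algebra.intro lie_conformal_algebra_axioms.intro m linear_iff_vs
        vector_space_cscale vector_space_cscale_poly additive_vir vir_skew vir_jacobi vir_del_left
        vir_del_right) (simp_all add: c p vir_smult)
qed

lemma virasoro_L: "vir_bracket 1 1 = [:[:0, 1:], 2:]"
  by (rule eval2_ext) (simp add: eval2_vir eval2_simps)


subsection \<open>The tensor product\<close>

context unital_comm_algebra
begin

lemma tensor_coeff: "coeff (tensor sc p x) i = sc (coeff p i) x"
  by (simp add: tensor_def coeff_map_poly)

lemma tensor_add:
  "tensor sc (p + q) x = tensor sc p x + tensor sc q x"
  "tensor sc p (x + y) = tensor sc p x + tensor sc p y"
  by (auto intro!: poly_eqI simp: tensor_coeff scale_left_distrib scale_right_distrib)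

lemma tensor_scale:
  "tensor sc (smult c p) x = map_poly (sc c) (tensor sc p x)"
  "tensor sc p (sc c x) = map_poly (sc c) (tensor sc p x)"
  by (auto intro!: poly_eqI simp: tensor_coeff coeff_map_poly mult.commute)

lemma additive_tensor: "additive (\<lambda>p. tensor sc p x)" "additive (tensor sc p)"
  by (simp_all add: additive_def tensor_add)

lemma tensor_0 [simp]: "tensor sc 0 x = 0" "tensor sc p 0 = 0"
  using additive_tensor[THEN additive.zero] by auto

lemma tensor_lift_bound:
  fixes h :: "complex poly \<Rightarrow> 'a \<Rightarrow> 'w::ab_group_add"
  assumes "\<And>p. additive (h p)" "degree f \<le> n"
  shows "tensor_lift h f = (\<Sum>i\<le>n. h (monom 1 i) (coeff f i))"
  unfolding tensor_lift_def using assms(2)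
  by (intro sum.mono_neutral_left) (auto simp: coeff_eq_0 additive.zero[OF assms(1)])

lemma tensor_lift_additive:
  fixes h :: "complex poly \<Rightarrow> 'a \<Rightarrow> 'w::ab_group_add"
  assumes "\<And>p. additive (h p)"
  shows "additive (tensor_lift h)"
proof
  fix f g :: "'a poly"
  define n where "n = max (degree f) (degree g)"
  have b: "degree f \<le> n" "degree g \<le> n" "degree (f + g) \<le> n"
    by (auto simp: n_def degree_add_le_max)
  show "tensor_lift h (f + g) = tensor_lift h f + tensor_lift h g"
    unfolding b[THEN tensor_lift_bound[OF assms]]
    by (simp add: additive.add[OF assms] sum.distrib)
qed

lemma tensor_lift_tensor:
  fixes h :: "complex poly \<Rightarrow> 'a \<Rightarrow> 'w::ab_group_add"
  assumes "\<And>p. additive (h p)" "\<And>x. additive (\<lambda>p. h p x)"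
    and "\<And>c p x. h (smult c p) x = h p (sc c x)"
  shows "tensor_lift h (tensor sc p x) = h p x"
proof -
  have "tensor_lift h (tensor sc p x) = (\<Sum>i\<le>degree p. h (monom 1 i) (sc (coeff p i) x))"
    using tensor_lift_bound[where h = h and f = "tensor sc p x" and n = "degree p"] assms(1)
    by (simp add: tensor_coeff) (simp add: tensor_def map_poly_degree_leq)
  also have "\<dots> = h (\<Sum>i\<le>degree p. monom (coeff p i) i) x"
    by (simp add: additive.sum[OF assms(2)] assms(3)[symmetric] smult_monom)
  finally show ?thesis by (simp add: poly_as_sum_of_monoms)
qed

lemma tensor_monom: "tensor sc (monom 1 i) x = monom x i"
  by (auto intro!: poly_eqI simp: tensor_coeff)

lemma tensor_induct [case_names zero add tensor]:
  assumes "P 0" "\<And>f g. P f \<Longrightarrow> P g \<Longrightarrow> P (f + g)" "\<And>p x. P (tensor sc p x)"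
  shows "P f"
proof -
  have "P (\<Sum>i\<in>A. monom (coeff f i) i)" if "finite A" for A
    using that assms(3)[of "monom 1 _", unfolded tensor_monom]
    by (induction A rule: finite_induct) (auto intro: assms)
  from this[of "{..degree f}"] show ?thesis by (simp add: poly_as_sum_of_monoms)
qed

lemma additive_eqI:
  fixes F G :: "'a poly \<Rightarrow> 'w::ab_group_add"
  assumes "additive F" "additive G" "\<And>p x. F (tensor sc p x) = G (tensor sc p x)"
  shows "F f = G f"
  by (induction f rule: tensor_induct)
    (simp_all add: assms additive.zero[OF assms(1)] additive.zero[OF assms(2)]
      additive.add[OF assms(1)] additive.add[OF assms(2)])

text \<open>\<open>'a poly\<close> with \<^const>\<open>tensor\<close> is a tensor product of \<^typ>\<open>complex poly\<close> and \<open>'a\<close>.\<close>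

lemma map_poly_sc_vector_space: "vector_space (\<lambda>c. map_poly (sc c))"
  by unfold_locales
    (auto simp: coeff_map_poly scale_right_distrib scale_left_distrib intro!: poly_eqI)

theorem tensor_universal:
  fixes h :: "complex poly \<Rightarrow> 'a \<Rightarrow> 'w::ab_group_add"
  assumes "\<And>p. Vector_Spaces.linear sc sW (h p)"
    and "\<And>x. Vector_Spaces.linear smult sW (\<lambda>p. h p x)"
  shows "\<exists>!k. Vector_Spaces.linear (\<lambda>c. map_poly (sc c)) sW k \<and> (\<forall>p x. k (tensor sc p x) = h p x)"
proof (intro ex1I conjI allI)
  have a: "additive (h p)" "additive (\<lambda>p. h p x)" and s: "h (smult c p) x = sW c (h p x)"
    and s': "h p (sc c x) = sW c (h p x)" and W: "vector_space sW" for p x c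
    using assms by (auto simp: Vector_Spaces.linear_iff additive_def)
  interpret W: vector_space sW by (rule W)
  show t: "tensor_lift h (tensor sc p x) = h p x" for p x
    by (rule tensor_lift_tensor) (use a s s' in auto)
  have "tensor_lift h (map_poly (sc c) f) = sW c (tensor_lift h f)" for c f
    using tensor_lift_bound[where h = h and f = "map_poly (sc c) f" and n = "degree f"]
    by (simp add: a s' tensor_lift_def[of h f] map_poly_degree_leq coeff_map_poly W.scale_sum_right)
  then show "Vector_Spaces.linear (\<lambda>c. map_poly (sc c)) sW (tensor_lift h)"
    by (intro linear_iff_vs map_poly_sc_vector_space W tensor_lift_additive a)
  fix k assume k: "Vector_Spaces.linear (\<lambda>c. map_poly (sc c)) sW k \<and>
      (\<forall>p x. k (tensor sc p x) = h p x)"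
  then have "additive k" by (auto simp: Vector_Spaces.linear_iff additive_def)
  moreover have "additive (tensor_lift h)" by (rule tensor_lift_additive[OF a(1)])
  ultimately have "k f = tensor_lift h f" for f
    by (rule additive_eqI) (simp add: k t)
  then show "k = tensor_lift h" ..
qed


subsection \<open>The map Virasoro Lie conformal algebra\<close>

lemma map_vir_scale_tensor [simp]:
  "map_vir_scale sc r (tensor sc p x) = tensor sc (r * p) x"
  unfolding map_vir_scale_def
  by (rule tensor_lift_tensor) (auto simp: additive_def tensor_add tensor_scale algebra_simps)

lemma map_vir_scale_additive: "additive (map_vir_scale sc r)"
  unfolding map_vir_scale_def
  by (intro tensor_lift_additive) (simp add: additive_def tensor_add)

lemma map_vir_module: "module (map_vir_scale sc)"
proof
  note [simp] = additive.add[OF map_vir_scale_additive] additive.zero[OF map_vir_scale_additive]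
  show "map_vir_scale sc r (f + g) = map_vir_scale sc r f + map_vir_scale sc r g" for r f g
    by simp
  show "map_vir_scale sc (r + s) f = map_vir_scale sc r f + map_vir_scale sc s f" for r s f
    by (induction f rule: tensor_induct) (simp_all add: algebra_simps tensor_add)
  show "map_vir_scale sc r (map_vir_scale sc s f) = map_vir_scale sc (r * s) f" for r s f
    by (induction f rule: tensor_induct) (simp_all add: algebra_simps)
  show "map_vir_scale sc 1 f = f" for f
    by (induction f rule: tensor_induct) simp_all
qed

lemma cscale_map_vir: "cscale (map_vir_scale sc) c = map_poly (sc c)"
proof
  have 1: "additive (cscale (map_vir_scale sc) c)" "additive (map_poly (sc c))"
    using map_vir_scale_additive
    by (auto simp: cscale_def additive_def intro!: poly_eqI simp: coeff_map_poly scale_right_distrib)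
  show "cscale (map_vir_scale sc) c f = map_poly (sc c) f" for f
    by (rule additive_eqI[OF 1]) (simp add: cscale_def tensor_scale)
qed

lemma map_tensor_zero: "map_poly (\<lambda>r. tensor sc r 0) q = 0"
  by (auto intro!: poly_eqI simp: coeff_map_poly)

lemma additive_map_tensor:
  "additive (\<lambda>x. map_poly (\<lambda>r. tensor sc r x) q)" "additive (map_poly (\<lambda>r. tensor sc r x))"
  by (rule map_poly_additive_fun map_poly_additive additive_tensor)+

lemma map_tensor_balanced:
  "map_poly (\<lambda>r. tensor sc r x) (map_poly (smult c) q) = map_poly (\<lambda>r. tensor sc r (sc c x)) q"
  by (auto intro!: poly_eqI simp: coeff_map_poly tensor_scale)

lemma scale_mult_right: "sc c (x * y) = x * sc c y"
  using scale_mult_left[of c y x] by (simp add: mult.commute)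

lemma inner_additive:
  fixes q :: "complex poly poly"
  shows "additive (\<lambda>y. map_poly (\<lambda>r. tensor sc r (x * y)) q)"
   "additive (\<lambda>x. map_poly (\<lambda>r. tensor sc r (x * y)) q)"
  using additive_map_tensor(1)[of q] by (auto simp: additive_def algebra_simps)

lemma map_vir_bracket_tensor_aux:
  "tensor_lift (\<lambda>v y. map_poly (\<lambda>r. tensor sc r (x * y)) (vir_bracket u v)) (tensor sc q y) =
     map_poly (\<lambda>r. tensor sc r (x * y)) (vir_bracket u q)"
  by (rule tensor_lift_tensor[OF inner_additive(1)
        additive_comp[OF additive_map_tensor(2) additive_vir(1)]])
    (simp add: vir_smult map_tensor_balanced scale_mult_right)

lemma additive_map_vir_bracket:
  "additive (map_vir_bracket sc f)" "additive (\<lambda>f. map_vir_bracket sc f g)"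
proof -
  have 1: "additive (tensor_lift (\<lambda>v y. map_poly (\<lambda>r. tensor sc r (x * y)) (vir_bracket u v)))" for x u
    by (intro tensor_lift_additive inner_additive)
  have 2: "additive (\<lambda>x. tensor_lift (\<lambda>v y. map_poly (\<lambda>r. tensor sc r (x * y)) (vir_bracket u v)) g)"
    for u g
    unfolding tensor_lift_def
    by standard (simp add: additive.add[OF inner_additive(2)] sum.distrib)
  show "additive (map_vir_bracket sc f)"
    unfolding map_vir_bracket_def tensor_lift_def[of _ f]
    by standard (simp add: additive.add[OF 1] sum.distrib)
  show "additive (\<lambda>f. map_vir_bracket sc f g)"
    unfolding map_vir_bracket_def by (intro tensor_lift_additive 2)
qed

theorem map_vir_bracket_tensor:
  "map_vir_bracket sc (tensor sc p x) (tensor sc q y) =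
     map_poly (\<lambda>r. tensor sc r (x * y)) (vir_bracket p q)"
proof -
  let ?h = "\<lambda>u x. tensor_lift (\<lambda>v y. map_poly (\<lambda>r. tensor sc r (x * y)) (vir_bracket u v)) (tensor sc q y)"
  have "tensor_lift ?h (tensor sc p x) = ?h p x"
    unfolding map_vir_bracket_tensor_aux
    by (rule tensor_lift_tensor[OF inner_additive(2)
          additive_comp[OF additive_map_tensor(2) additive_vir(2)]])
      (simp add: vir_smult map_tensor_balanced scale_mult_left)
  then show ?thesis by (simp add: map_vir_bracket_def map_vir_bracket_tensor_aux)
qed

text \<open>\<open>[L\<^sub>x \<^sub>\<lambda> L\<^sub>y] = (\<partial> + 2\<lambda>) L\<^sub>x\<^sub>y\<close>\<close>

corollary map_vir_bracket_L:
  "map_vir_bracket sc (tensor sc 1 x) (tensor sc 1 y) =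
     [:map_vir_scale sc [:0, 1:] (tensor sc 1 (x * y)), map_vir_scale sc 2 (tensor sc 1 (x * y)):]"
  by (auto simp: map_vir_bracket_tensor virasoro_L map_poly_pCons)

lemma map_tensor_var:
  "map_poly (\<lambda>r. tensor sc r x) (var_times q) = var_times (map_poly (\<lambda>r. tensor sc r x) q)"
  by (simp add: map_poly_pCons)

lemma map_tensor_del:
  "map_poly (\<lambda>r. tensor sc r x) (map_poly (\<lambda>p. s * p) q) =
     map_poly (map_vir_scale sc s) (map_poly (\<lambda>r. tensor sc r x) q)"
  by (auto intro!: poly_eqI simp: coeff_map_poly additive.zero[OF map_vir_scale_additive])

lemma map_vir_skew:
  "map_vir_bracket sc f g =
     - poly_subst (\<lambda>q. - var_times q - map_poly (del (map_vir_scale sc)) q) (\<lambda>c. [:c:])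
       (map_vir_bracket sc g f)" (is "_ = - poly_subst ?X _ _")
proof -
  have X: "additive ?X"
    using map_poly_additive[OF map_vir_scale_additive] by (simp add: additive_def)
  note addb = additive_map_vir_bracket
  have S: "additive (\<lambda>q. - poly_subst ?X (\<lambda>c. [:c:]) q)"
    using poly_subst_additive[OF X additive_const_poly(1)] by (simp add: additive_def)
  have pure: "map_vir_bracket sc (tensor sc p x) (tensor sc q y) =
      - poly_subst ?X (\<lambda>c. [:c:]) (map_vir_bracket sc (tensor sc q y) (tensor sc p x))" for p x q y
    unfolding map_vir_bracket_tensor
    apply (subst vir_skew)
    apply (subst additive.minus[OF additive_map_tensor(2)])
    apply (subst poly_subst_map[where G = "map_poly (\<lambda>r. tensor sc r (x * y))"
          and X' = ?X and f' = "\<lambda>c. [:c:]" and g = "\<lambda>r. tensor sc r (x * y)"])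
    using X by (auto simp: additive_tensor additive_map_tensor additive_const_poly map_tensor_var
        map_tensor_del map_poly_pCons additive.diff[OF additive_map_tensor(2)]
        additive.minus[OF additive_map_tensor(2)] mult.commute)
  have "map_vir_bracket sc (tensor sc p x) g =
      - poly_subst ?X (\<lambda>c. [:c:]) (map_vir_bracket sc g (tensor sc p x))" for p x
    by (rule additive_eqI[where f = g, OF addb(1) additive_comp[OF S addb(2)] pure])
  then show ?thesis
    by (rule additive_eqI[where f = f, OF addb(2) additive_comp[OF S addb(1)]])
qed

lemma map_vir_jacobi:
  "act_lam_mu (map_vir_bracket sc) f g h =
     act_bracket (map_vir_bracket sc) (map_vir_bracket sc) f g h +
     act_mu_lam (map_vir_bracket sc) g f h"
proof -
  let ?b = "map_vir_bracket sc"
  note addb = additive_map_vir_bracket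
  note A = additive_act_lam_mu[of ?b, OF addb addb]
    and B = additive_act_bracket[of ?b ?b, OF addb addb]
    and C = additive_act_mu_lam[of ?b, OF addb addb]
  define T where "T = (\<lambda>x. map_poly (map_poly (\<lambda>r. tensor sc r x)))"
  have addT: "additive (T x)" for x
    unfolding T_def by (intro map_poly_additive additive_tensor)
  have T0: "T x 0 = 0" for x by (simp add: T_def)
  have lam: "T x (lam_times q) = lam_times (T x q)" for x q
    unfolding T_def lam_times_def
    by (auto intro!: poly_eqI simp: coeff_map_poly coeff_pCons split: nat.split)
  have mu: "T x (mu_times q) = mu_times (T x q)" for x q
    unfolding T_def mu_times_def by (simp add: map_poly_pCons)
  have at_mu: "T x (at_mu q) = at_mu (map_poly (\<lambda>r. tensor sc r x) q)" for x q
    unfolding T_def at_mu_def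
    by (auto intro!: poly_eqI simp: coeff_map_poly coeff_pCons split: nat.split)
  have at_lm: "T x (at_lam_plus_mu q) = at_lam_plus_mu (map_poly (\<lambda>r. tensor sc r x) q)" for x q
    unfolding at_lam_plus_mu_def
    by (rule poly_subst_map)
      (auto simp: addT additive_tensor additive_lam_mu additive.add[OF addT] lam mu
        additive_def[of "\<lambda>c. [:[:c:]:]"], simp add: T_def map_poly_pCons)
  have pure: "act_lam_mu ?b (tensor sc p x) (tensor sc q y) (tensor sc r z) =
      act_bracket ?b ?b (tensor sc p x) (tensor sc q y) (tensor sc r z) +
      act_mu_lam ?b (tensor sc q y) (tensor sc p x) (tensor sc r z)" for p x q y r z
  proof -
    let ?w = "x * (y * z)"
    have 1: "act_lam_mu ?b (tensor sc p x) (tensor sc q y) (tensor sc r z) =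
        T ?w (act_lam_mu vir_bracket p q r)"
      unfolding act_lam_mu_def map_vir_bracket_tensor T_def
      by (auto intro!: poly_eqI[of "map_poly _ _ :: 'a poly poly poly"]
          simp: coeff_map_poly map_vir_bracket_tensor additive.zero[OF addb(1)])
    have 2: "T ?w (act_bracket vir_bracket vir_bracket p q r) =
        act_bracket ?b ?b (tensor sc p x) (tensor sc q y) (tensor sc r z)"
      unfolding act_bracket_def map_vir_bracket_tensor
      by (rule poly_subst_map)
        (simp_all add: addT additive_tensor additive_lam_times lam at_lm map_vir_bracket_tensor
          mult.assoc additive_comp[OF additive_at_lam_plus_mu addb(2)])
    have 3: "T ?w (act_mu_lam vir_bracket q p r) =
        act_mu_lam ?b (tensor sc q y) (tensor sc p x) (tensor sc r z)"
      unfolding act_mu_lam_def map_vir_bracket_tensor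
      by (rule poly_subst_map)
        (simp_all add: addT additive_tensor additive_lam_times lam at_mu map_vir_bracket_tensor
          mult.left_commute additive_comp[OF additive_at_mu addb(1)])
    show ?thesis
      unfolding 1 2[symmetric] 3[symmetric] vir_jacobi by (rule additive.add[OF addT])
  qed
  have add2: "additive (\<lambda>x. F x + G x)" if "additive F" "additive G"
    for F G :: "'a poly \<Rightarrow> 'a poly poly poly"
    using that by (simp add: additive_def)
  have s1: "act_lam_mu ?b (tensor sc p x) (tensor sc q y) h =
      act_bracket ?b ?b (tensor sc p x) (tensor sc q y) h +
      act_mu_lam ?b (tensor sc q y) (tensor sc p x) h" for p x q y
    by (rule additive_eqI[where f = h, OF A(1) add2[OF B(1) C(1)] pure])
  have s2: "act_lam_mu ?b (tensor sc p x) g h =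
      act_bracket ?b ?b (tensor sc p x) g h + act_mu_lam ?b g (tensor sc p x) h" for p x
    by (rule additive_eqI[where f = g, OF A(2) add2[OF B(2) C(2)] s1])
  show ?thesis
    by (rule additive_eqI[where f = f, OF A(3) add2[OF B(3) C(3)] s2])
qed

theorem map_vir_lie_conformal_algebra:
  "lie_conformal_algebra (map_vir_scale sc) (map_vir_bracket sc)"
proof -
  let ?b = "map_vir_bracket sc"
  interpret V: vector_space "cscale_poly (map_vir_scale sc)"
    by (rule vector_space_cscale_poly[OF map_vir_module])
  note addb = additive_map_vir_bracket
  have addc: "additive (cscale (map_vir_scale sc) c)" for c
    by (simp add: additive_def cscale_def module.scale_right_distrib[OF map_vir_module])
  have addp: "additive (cscale_poly (map_vir_scale sc) c)" for c
    by (simp add: additive_def V.scale_right_distrib)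
  have addd: "additive (map_poly (map_vir_scale sc s))" for s
    by (intro map_poly_additive map_vir_scale_additive)
  have bi: "F f g = G f g"
    if "\<And>f. additive (F f)" "\<And>g. additive (\<lambda>f. F f g)" "\<And>f. additive (G f)"
      "\<And>g. additive (\<lambda>f. G f g)"
      "\<And>p x q y. F (tensor sc p x) (tensor sc q y) = G (tensor sc p x) (tensor sc q y)"
    for F G :: "'a poly \<Rightarrow> 'a poly \<Rightarrow> 'a poly poly" and f g
    by (rule additive_eqI[where f = f], rule that, rule that, rule additive_eqI[where f = g])
      (intro that)+
  have cs: "cscale (map_vir_scale sc) c (tensor sc p x) = tensor sc (smult c p) x" for c p x
    by (simp add: cscale_def)
  have cp: "cscale_poly (map_vir_scale sc) c (map_poly (\<lambda>r. tensor sc r x) q) =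
      map_poly (\<lambda>r. tensor sc r x) (map_poly (smult c) q)" for c q x
    by (auto intro!: poly_eqI simp: cscale_poly_def coeff_map_poly cs additive.zero[OF addc])
  have lin_r: "?b f (cscale (map_vir_scale sc) c g) = cscale_poly (map_vir_scale sc) c (?b f g)"
    for c f g
    by (rule bi[where F = "\<lambda>f g. ?b f (cscale (map_vir_scale sc) c g)",
          OF additive_comp[OF addb(1) addc] addb(2) additive_comp[OF addp addb(1)]
            additive_comp[OF addp addb(2)]])
      (simp add: cs cp map_vir_bracket_tensor vir_smult)
  have lin_l: "?b (cscale (map_vir_scale sc) c f) g = cscale_poly (map_vir_scale sc) c (?b f g)"
    for c f g
    by (rule bi[where F = "\<lambda>f g. ?b (cscale (map_vir_scale sc) c f) g",
          OF addb(1) additive_comp[OF addb(2) addc] additive_comp[OF addp addb(1)]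
            additive_comp[OF addp addb(2)]])
      (simp add: cs cp map_vir_bracket_tensor vir_smult)
  have neg: "additive (\<lambda>x. - var_times (F x))" if "additive F"
    for F :: "'a poly \<Rightarrow> 'a poly poly"
    using that by (simp add: additive_def)
  have plus: "additive (\<lambda>x. map_poly (map_vir_scale sc s) (F x) + var_times (F x))" if "additive F"
    for s and F :: "'a poly \<Rightarrow> 'a poly poly"
    using that addd[of s] by (simp add: additive_def)
  have del_l: "?b (del (map_vir_scale sc) f) g = - var_times (?b f g)" for f g
    by (rule bi[where F = "\<lambda>f g. ?b (del (map_vir_scale sc) f) g",
          OF addb(1) additive_comp[OF addb(2) map_vir_scale_additive] neg[OF addb(1)]
            neg[OF addb(2)]])
      (simp only: map_vir_scale_tensor map_vir_bracket_tensor vir_del_left map_tensor_var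
          additive.minus[OF additive_map_tensor(2)])
  have del_r: "?b f (del (map_vir_scale sc) g) =
      map_poly (del (map_vir_scale sc)) (?b f g) + var_times (?b f g)" for f g
    by (rule bi[where F = "\<lambda>f g. ?b f (del (map_vir_scale sc) g)",
          OF additive_comp[OF addb(1) map_vir_scale_additive] addb(2) plus[OF addb(1)]
            plus[OF addb(2)]])
      (simp only: map_vir_scale_tensor map_vir_bracket_tensor vir_del_right map_tensor_var
          map_tensor_del additive.add[OF additive_map_tensor(2)])
  show ?thesis
    by (intro lie_conformal_algebra.intro lie_conformal_algebra_axioms.intro map_vir_module
        linear_iff_vs vector_space_cscale vector_space_cscale_poly addb map_vir_skew
        map_vir_jacobi del_l del_r lin_l lin_r)
qed

end

end

theory Submission
  imports Defs "HOL-Library.Nat_Bijection" "HOL-Computational_Algebra.Fundamental_Theorem_Algebra"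
begin

text \<open>
  Both parts rest on the operator \<open>D = L\<^sub>(\<^sub>0\<^sub>) - \<partial>\<close>, where \<open>L\<^sub>(\<^sub>0\<^sub>)\<close> is the \<open>\<lambda>^0\<close>-coefficient of \<open>L\<^sub>1 \<^sub>\<lambda>\<close>.
  It commutes with \<open>\<partial>\<close> and with every \<open>L\<^sub>x \<^sub>\<lambda>\<close>. Comparing leading coefficients in \<open>\<lambda>\<close> in a relation
  \<open>\<Sum>\<^sub>k q\<^sub>k(\<partial>) D^k m = 0\<close> shows that the coefficients of \<open>L\<^sub>x \<^sub>\<lambda> m\<close> are annihilated by nonzero polynomials
  in \<open>D\<close> with constant coefficients.

  (1) Hence \<open>D\<close> has an eigenvector, with eigenvalue \<open>c\<close>, say. On the submodule \<open>ker (D - c)\<close> one has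
  \<open>L\<^sub>(\<^sub>0\<^sub>) = \<partial> + c\<close>. Choose in it a nonzero submodule \<open>P\<close> of minimal rank. If \<open>P'\<close> is a nonzero submodule
  of \<open>P\<close>, then \<open>P / P'\<close> is torsion, hence a trivial module, so \<open>(\<partial> + c) P \<subseteq> P'\<close>. The intersection of
  all \<open>P'\<close> is therefore nonzero, and it is irreducible.

  (2) Write \<open>B\<^sub>x\<close> for the \<open>\<lambda>^0\<close>-coefficient of \<open>L\<^sub>x \<^sub>\<lambda>\<close>; it is \<open>\<complex>[\<partial>]\<close>-linear and determines the action of
  \<open>L\<^sub>x\<close>. Commuting \<open>\<Sum> p\<^sub>i(\<partial>) B\<^bsub>x\<^sub>i\<^esub>\<close> with the \<open>\<lambda>\<close>-coefficient of \<open>L\<^sub>1 \<^sub>\<lambda>\<close> shows that if this sum maps into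
  the torsion submodule, then so does \<open>\<Sum> p\<^sub>i'(\<partial>) B\<^bsub>x\<^sub>i\<^esub>\<close>. After repeated differentiation, a relation over
  \<open>\<complex>[\<partial>]\<close>, which exists as soon as there are more \<open>x\<^sub>i\<close> than the square of the number of generators,
  becomes a relation over \<open>\<complex>\<close> modulo the finite-dimensional torsion submodule.
\<close>

section \<open>Homogeneous linear systems over an integral domain\<close>

text \<open>Gaussian elimination without division: each step cross-multiplies with a nonzero pivot,
  and the absence of zero divisors keeps the solution nontrivial.\<close>

lemma homogeneous_system_nontrivial_solution:
  fixes a :: "'i \<Rightarrow> 'e \<Rightarrow> 'r::idom"
  assumes "finite E" "finite I" "card E < card I"
  shows "\<exists>q. (\<exists>i\<in>I. q i \<noteq> 0) \<and> (\<forall>e\<in>E. (\<Sum>i\<in>I. q i * a i e) = 0)"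
  using assms
proof (induction E arbitrary: I a rule: finite_induct)
  case empty
  then have "I \<noteq> {}" by auto
  then show ?case by (intro exI[of _ "\<lambda>_. 1"]) auto
next
  case (insert e E)
  show ?case
  proof (cases "\<forall>i\<in>I. a i e = 0")
    case True
    obtain q where "\<exists>i\<in>I. q i \<noteq> 0" "\<forall>e\<in>E. (\<Sum>i\<in>I. q i * a i e) = 0"
      using insert.IH[OF insert.prems(1), of a] insert.prems insert.hyps by auto
    then show ?thesis using True by (intro exI[of _ q]) auto
  next
    case False
    then obtain i0 where i0: "i0 \<in> I" "a i0 e \<noteq> 0" by blast
    define J where "J = I - {i0}"
    have J: "finite J" "i0 \<notin> J" "I = insert i0 J"
      using insert.prems i0 by (auto simp: J_def)
    have "card E < card J" using insert.prems insert.hyps J by simp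
    from insert.IH[OF J(1) this, of "\<lambda>i e'. a i0 e * a i e' - a i e * a i0 e'"]
    obtain q where q: "\<exists>i\<in>J. q i \<noteq> 0"
      "\<And>e'. e' \<in> E \<Longrightarrow> (\<Sum>i\<in>J. q i * (a i0 e * a i e' - a i e * a i0 e')) = 0"
      by blast
    \<comment> \<open>Equation \<open>e\<close> is solved for the pivot unknown; the other unknowns
      are scaled by the pivot to avoid a division.\<close>
    define q' where "q' i = (if i = i0 then - (\<Sum>i\<in>J. q i * a i e) else a i0 e * q i)" for i
    have sum: "(\<Sum>i\<in>I. q' i * a i e') =
        (\<Sum>i\<in>J. q i * (a i0 e * a i e' - a i e * a i0 e'))" for e'
    proof -
      have "(\<Sum>i\<in>J. q' i * a i e') = (\<Sum>i\<in>J. a i0 e * q i * a i e')"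
        using J by (intro sum.cong) (auto simp: q'_def)
      then have "(\<Sum>i\<in>I. q' i * a i e') =
          (\<Sum>i\<in>J. a i0 e * q i * a i e') - (\<Sum>i\<in>J. q i * a i e) * a i0 e'"
        using J by (simp add: q'_def)
      also have "\<dots> = (\<Sum>i\<in>J. q i * (a i0 e * a i e' - a i e * a i0 e'))"
        by (simp add: right_diff_distrib sum_subtractf sum_distrib_right sum_distrib_left mult_ac)
      finally show ?thesis .
    qed
    have "\<exists>i\<in>I. q' i \<noteq> 0" using q(1) i0 J by (auto simp: q'_def)
    moreover have "\<forall>e'\<in>insert e E. (\<Sum>i\<in>I. q' i * a i e') = 0"
      unfolding sum using q(2) by (auto simp: mult.commute)
    ultimately show ?thesis by blast
  qed
qed


section \<open>Finitely generated modules over \<open>\<complex>[\<partial>]\<close>\<close>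

lemma (in module) span_finite_coeffs:
  assumes "finite G" "v \<in> span G"
  shows "\<exists>c. v = (\<Sum>g\<in>G. c g *s g)"
  using assms(2) unfolding span_finite[OF assms(1)] by auto


locale complex_poly_module = module s for s :: "complex poly \<Rightarrow> 'm::ab_group_add \<Rightarrow> 'm"
begin

lemma span_relation:
  assumes "finite G" "finite I" "card G < card I" "\<And>i. i \<in> I \<Longrightarrow> v i \<in> span G"
  shows "\<exists>q. (\<exists>i\<in>I. q i \<noteq> 0) \<and> (\<Sum>i\<in>I. s (q i) (v i)) = 0"
proof -
  obtain c where c: "\<And>i. i \<in> I \<Longrightarrow> v i = (\<Sum>g\<in>G. s (c i g) g)"
    using span_finite_coeffs[OF assms(1) assms(4)] by metis
  obtain q where q: "\<exists>i\<in>I. q i \<noteq> 0" "\<And>g. g \<in> G \<Longrightarrow> (\<Sum>i\<in>I. q i * c i g) = 0"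
    using homogeneous_system_nontrivial_solution[OF assms(1-3), of c] by blast
  have "(\<Sum>i\<in>I. s (q i) (v i)) = (\<Sum>i\<in>I. \<Sum>g\<in>G. s (q i * c i g) g)"
    by (intro sum.cong) (auto simp: c scale_sum_right)
  also have "\<dots> = (\<Sum>g\<in>G. s (\<Sum>i\<in>I. q i * c i g) g)"
    by (subst sum.swap) (simp add: scale_sum_left)
  also have "\<dots> = 0" by (simp add: q(2))
  finally show ?thesis using q(1) by blast
qed

lemma independent_card_le:
  assumes "finite G" "S \<subseteq> span G" "independent S"
  shows "finite S \<and> card S \<le> card G"
proof (rule ccontr)
  assume "\<not> ?thesis"
  then have "infinite S \<or> card G < card S" by auto
  then obtain U where U: "U \<subseteq> S" "finite U" "card G < card U"
    by (metis infinite_arbitrarily_large lessI order_refl)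
  obtain q where "\<exists>i\<in>U. q i \<noteq> 0" "(\<Sum>i\<in>U. s (q i) i) = 0"
    using span_relation[OF assms(1) U(2,3), of "\<lambda>v. v"] U assms(2) by blast
  then show False using independentD[OF assms(3) U(2,1)] by blast
qed

text \<open>Modulo \<open>span G\<close>, the coefficients of \<open>e\<close> occurring in
  \<open>N\<close> form an ideal of \<complex>[\<partial>], generated by an element of least degree.
  A lift of it to \<open>N\<close>, together with generators of \<open>N \<inter> span G\<close>,
  spans \<open>N\<close>.\<close>

lemma subspace_span_finite:
  assumes "finite G" "subspace N" "N \<subseteq> span G"
  shows "\<exists>H. finite H \<and> span H = N"
  using assms
proof (induction G arbitrary: N rule: finite_induct)
  case empty
  then have "span {} = N" using subspace_0 by (auto simp: span_empty)
  then show ?case by blast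
next
  case (insert e G)
  have sub: "subspace (N \<inter> span G)" using insert.prems by (simp add: subspace_inter)
  obtain H where H: "finite H" "span H = N \<inter> span G"
    using insert.IH[OF sub] by auto
  define Id where "Id = {p. \<exists>u\<in>span G. s p e + u \<in> N}"
  show ?case
  proof (cases "Id \<subseteq> {0}")
    case True
    have "N \<subseteq> span G"
    proof
      fix n assume n: "n \<in> N"
      obtain p where p: "n - s p e \<in> span G"
        using insert.prems n by (metis span_breakdown_eq subsetD)
      then have "p \<in> Id" using n unfolding Id_def
        by (intro CollectI bexI[of _ "n - s p e"]) auto
      then show "n \<in> span G" using True p by auto
    qed
    then show ?thesis using H by (metis inf.absorb1)
  next
    case False
    then obtain p1 where p1: "p1 \<in> Id \<and> p1 \<noteq> 0" by blast
    define p where "p = (ARG_MIN degree p. p \<in> Id \<and> p \<noteq> 0)"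
    have p: "p \<in> Id" "p \<noteq> 0" and least: "\<And>r. r \<in> Id \<Longrightarrow> r \<noteq> 0 \<Longrightarrow> degree p \<le> degree r"
      using arg_min_nat_lemma[of "\<lambda>p. p \<in> Id \<and> p \<noteq> 0", OF p1, of degree] unfolding p_def by auto
    obtain u where u: "u \<in> span G" "s p e + u \<in> N" using p(1) by (auto simp: Id_def)
    define h where "h = s p e + u"
    have "span (insert h H) = N"
    proof
      have "insert h H \<subseteq> N" using u H span_superset[of H] by (auto simp: h_def)
      then show "span (insert h H) \<subseteq> N" using insert.prems by (simp add: span_minimal)
      show "N \<subseteq> span (insert h H)"
      proof
        fix n assume n: "n \<in> N"
        obtain a where a: "n - s a e \<in> span G"
          using insert.prems n by (metis span_breakdown_eq subsetD)
        define n' where "n' = n - s (a div p) h"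
        have n'N: "n' \<in> N" using n u insert.prems
          by (simp add: n'_def h_def subspace_diff subspace_scale)
        have n'_eq: "n' = s (a mod p) e + ((n - s a e) - s (a div p) u)"
        proof -
          have "s a e = s (a div p * p + a mod p) e" by simp
          also have "\<dots> = s (a div p) (s p e) + s (a mod p) e"
            by (simp only: scale_left_distrib scale_scale)
          finally show ?thesis by (simp add: n'_def h_def scale_right_distrib)
        qed
        have w: "(n - s a e) - s (a div p) u \<in> span G"
          using a u by (simp add: span_diff span_scale)
        then have "a mod p \<in> Id" using n'N n'_eq unfolding Id_def by auto
        then have "a mod p = 0"
          using least[of "a mod p"] degree_mod_less[of p a] p(2) by (meson not_le)
        then have "n' \<in> span G" using w n'_eq by simp
        then have "n' \<in> span H" using H n'N by simp
        then have "n' \<in> span (insert h H)" using span_mono[of H "insert h H"] by auto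
        moreover have "s (a div p) h \<in> span (insert h H)"
          by (intro span_scale span_base) simp
        moreover have "n = n' + s (a div p) h" by (simp add: n'_def)
        ultimately show "n \<in> span (insert h H)" by (simp add: span_add)
      qed
    qed
    then show ?thesis using H(1) by blast
  qed
qed

definition torsion :: "'m set" where
  "torsion = {m. \<exists>p. p \<noteq> 0 \<and> s p m = 0}"

lemma torsion_subspace: "subspace torsion"
proof (rule subspaceI)
  show "0 \<in> torsion" unfolding torsion_def by (auto intro: exI[of _ 1])
  fix x y assume "x \<in> torsion" "y \<in> torsion"
  then obtain p q where "p \<noteq> 0" "q \<noteq> 0" "s p x = 0" "s q y = 0" by (auto simp: torsion_def)
  moreover from this have "s (p * q) (x + y) = 0"
    by (metis add.right_neutral mult.commute scale_right_distrib scale_scale scale_zero_right)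
  ultimately show "x + y \<in> torsion" unfolding torsion_def by (auto intro!: exI[of _ "p * q"])
next
  fix c x assume "x \<in> torsion"
  then obtain p where "p \<noteq> 0" "s p x = 0" by (auto simp: torsion_def)
  moreover from this have "s p (s c x) = 0" by (metis mult.commute scale_scale scale_zero_right)
  ultimately show "s c x \<in> torsion" unfolding torsion_def by blast
qed

lemma torsion_cancel:
  assumes "p \<noteq> 0" "s p m \<in> torsion" shows "m \<in> torsion"
proof -
  obtain q where "q \<noteq> 0" "s q (s p m) = 0" using assms(2) by (auto simp: torsion_def)
  then show ?thesis using assms(1) unfolding torsion_def by (auto intro!: exI[of _ "q * p"])
qed

lemma torsion_free_free_module:
  assumes "free_module s" shows "torsion = {0}"
proof -
  obtain B where B: "independent B" "span B = UNIV" using assms by (auto simp: free_module_def)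
  have "m = 0" if m: "p \<noteq> 0" "s p m = 0" for p m
  proof -
    obtain U c where U: "finite U" "U \<subseteq> B" "m = (\<Sum>b\<in>U. s (c b) b)"
      using B(2) unfolding span_explicit by blast
    have "(\<Sum>b\<in>U. s (p * c b) b) = 0" using m U by (simp add: scale_sum_right)
    then have "p * c b = 0" if "b \<in> U" for b
      by (rule independentD[OF B(1) U(1,2) _ that])
    then show ?thesis using U m by simp
  qed
  then show ?thesis unfolding torsion_def by (auto intro: exI[of _ 1])
qed

text \<open>Each of the finitely many generators of \<open>torsion\<close> is killed by a nonzero
  polynomial; reducing coefficients modulo it leaves finitely many powers of \<partial>.\<close>

lemma torsion_finite_dim:
  assumes "finite_module s"
  shows "\<exists>H. finite H \<and> (\<forall>t\<in>torsion. \<exists>c. t = (\<Sum>h\<in>H. s [:c h:] h))"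
proof -
  obtain G where G: "finite G" "span G = UNIV" using assms by (auto simp: finite_module_def)
  obtain H where H: "finite H" "span H = torsion"
    using subspace_span_finite[OF G(1) torsion_subspace] G(2) by auto
  then have "\<exists>p. p \<noteq> 0 \<and> s p h = 0" if "h \<in> H" for h
    using that span_base[of h H] by (auto simp: torsion_def)
  then obtain p where p: "\<And>h. h \<in> H \<Longrightarrow> p h \<noteq> 0 \<and> s (p h) h = 0" by metis
  define K where "K = (SIGMA h:H. {..degree (p h)})"
  define v where "v = (\<lambda>(h, k). s (monom 1 k) h)"
  interpret V: vector_space "\<lambda>c. s [:c:]"
    using vector_space_cscale[OF module_axioms] by (simp add: cscale_def[abs_def])
  have fin: "finite (v ` K)" using H by (simp add: K_def)
  have "t \<in> V.span (v ` K)" if "t \<in> torsion" for t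
  proof -
    have "t \<in> span H" using that H(2) by simp
    from span_finite_coeffs[OF H(1) this] obtain r where r: "t = (\<Sum>h\<in>H. s (r h) h)" ..
    have "s (r h) h \<in> V.span (v ` K)" if h: "h \<in> H" for h
    proof -
      let ?q = "r h mod p h"
      have dq: "degree ?q \<le> degree (p h)"
        using degree_mod_less[of "p h" "r h"] p[OF h] by auto
      have "s (r h) h = s (r h div p h * p h + ?q) h" by simp
      also have "\<dots> = s (r h div p h) (s (p h) h) + s ?q h"
        by (simp only: scale_left_distrib scale_scale)
      also have "\<dots> = s ?q h" using p[OF h] by simp
      also have "\<dots> = s (\<Sum>k\<le>degree (p h). monom (coeff ?q k) k) h"
        using poly_as_sum_of_monoms'[OF dq] by simp
      also have "\<dots> = (\<Sum>k\<le>degree (p h). s [:coeff ?q k:] (v (h, k)))"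
        by (simp add: v_def scale_sum_left smult_monom)
      also have "\<dots> \<in> V.span (v ` K)"
        using h by (intro V.span_sum V.span_scale V.span_base) (auto simp: K_def)
      finally show ?thesis .
    qed
    then show ?thesis unfolding r by (intro V.span_sum)
  qed
  then have "\<exists>c. t = (\<Sum>h\<in>v ` K. s [:c h:] h)" if "t \<in> torsion" for t
    by (intro V.span_finite_coeffs[OF fin]) (simp add: that)
  with fin show ?thesis by blast
qed

end


section \<open>Coefficients of the \<open>\<lambda>\<close>-action\<close>

text \<open>
  \<open>L x j m\<close> is the coefficient of \<open>\<lambda>^j\<close> in \<open>L\<^sub>x \<^sub>\<lambda> m\<close>. The assumptions \<open>comm_0\<close> and \<open>comm_Suc\<close> are the
  coefficients of \<open>\<lambda>^0 \<mu>^j\<close> in \<open>[L\<^sub>x \<^sub>\<lambda>, L\<^sub>y \<^sub>\<mu>] = (\<lambda> - \<mu>) L\<^sub>x\<^sub>y \<^sub>\<lambda>\<^sub>+\<^sub>\<mu>\<close>; no other part of the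
  Jacobi identity is needed.
\<close>

locale virasoro_operators = complex_poly_module s
  for s :: "complex poly \<Rightarrow> 'm::ab_group_add \<Rightarrow> 'm" +
  fixes L :: "'a::{comm_ring, comm_monoid_mult} \<Rightarrow> nat \<Rightarrow> 'm \<Rightarrow> 'm"
  assumes L_add: "L x j (m + n) = L x j m + L x j n"
    and L_const: "L x j (s [:c:] m) = s [:c:] (L x j m)"
    and L_del_0: "L x 0 (s [:0, 1:] m) = s [:0, 1:] (L x 0 m)"
    and L_del_Suc: "L x (Suc j) (s [:0, 1:] m) = s [:0, 1:] (L x (Suc j) m) + L x j m"
    and comm_0: "L x 0 (L y 0 m) = L y 0 (L x 0 m)"
    and comm_Suc: "L x 0 (L y (Suc j) m) - L y (Suc j) (L x 0 m) = - L (x * y) j m"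
    and L_eventually_0: "\<exists>n. \<forall>j>n. L x j m = 0"
begin

declare scale_scale [simp del]

lemma scale_commute: "s p (s q m) = s q (s p m)"
  by (simp add: scale_scale mult.commute)

lemma additive_L: "additive (L x j)"
  by standard (rule L_add)

lemmas L_zero = additive.zero[OF additive_L]
  and L_diff = additive.diff[OF additive_L]
  and L_sum = additive.sum[OF additive_L]

lemma scale_pCons: "s (pCons a q) m = s [:a:] m + s [:0, 1:] (s q m)"
proof -
  have "pCons a q = [:a:] + [:0, 1:] * q" by simp
  then show ?thesis by (simp only: scale_left_distrib scale_scale)
qed

lemma scale_linear: "s [:a, 1:] m = s [:a:] m + s [:0, 1:] m"
  using scale_pCons[of a 1 m] by (simp flip: one_pCons)

section \<open>Action on polynomial multiples, where p(\<partial>) becomes p(\<partial> +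
  \<lambda>)\<close>

lemma L_0_scale: "L x 0 (s p m) = s p (L x 0 m)"
proof (induction p)
  case 0
  then show ?case by (simp add: L_zero)
next
  case (pCons a p)
  then show ?case unfolding scale_pCons[of a p] by (simp add: L_add L_const L_del_0)
qed

lemma L_1_scale: "L x 1 (s p m) = s p (L x 1 m) + s (pderiv p) (L x 0 m)"
proof (induction p)
  case 0
  then show ?case by (simp add: L_zero)
next
  case (pCons a p)
  have "s (pderiv (pCons a p)) n = s p n + s [:0, 1:] (s (pderiv p) n)" for n
    using scale_pCons[of 0 "pderiv p" n] by (simp add: pderiv_pCons scale_left_distrib)
  then show ?case
    using pCons L_del_Suc[of x 0 "s p m"] unfolding scale_pCons[of a p]
    by (simp add: L_add L_const L_0_scale scale_right_distrib)
qed

text \<open>Modulo \<open>W\<close>, this is the top term in \<lambda> of p(\<partial> + \<lambda>)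
  applied to the action on \<open>m\<close>. \<open>K\<close> is only a bound for the degree, so
  that one exponent serves several polynomials at once.\<close>

lemma L_scale_leading:
  assumes W: "subspace W" and small: "\<And>j. j > r \<Longrightarrow> L x j m \<in> W" and "degree p \<le> K"
  shows "L x (r + K) (s p m) - s [:coeff p K:] (L x r m) \<in> W \<and>
    (\<forall>j > r + K. L x j (s p m) \<in> W)"
  using assms(3)
proof (induction K arbitrary: p)
  case 0
  then have p: "p = [:coeff p 0:]" using degree0_coeffs[of p] by auto
  have "L x j (s p m) = s [:coeff p 0:] (L x j m)" for j
    by (subst p) (rule L_const)
  then show ?case using small subspace_0[OF W] by (simp add: subspace_scale[OF W])
next
  case (Suc K)
  obtain a q where p: "p = pCons a q" by (cases p)
  then have "degree q \<le> K" using Suc.prems by (cases "q = 0") auto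
  note IH = Suc.IH[OF this]
  have expand: "L x (Suc j) (s p m) =
      s [:a:] (L x (Suc j) m) + (s [:0, 1:] (L x (Suc j) (s q m)) + L x j (s q m))" for j
    unfolding p scale_pCons[of a q] by (simp add: L_add L_const L_del_Suc)
  have lower: "s [:a:] (L x (Suc j) m) + s [:0, 1:] (L x (Suc j) (s q m)) \<in> W" if "j \<ge> r + K" for j
    using that IH small by (intro subspace_add[OF W] subspace_scale[OF W]) auto
  have "L x (Suc j) (s p m) \<in> W" if "j > r + K" for j
    using lower[of j] IH that subspace_add[OF W] unfolding expand add.assoc[symmetric] by auto
  then have "\<forall>j > r + Suc K. L x j (s p m) \<in> W"
    by (metis Suc_lessE add_Suc_right)
  moreover have "L x (r + Suc K) (s p m) - s [:coeff p (Suc K):] (L x r m) \<in> W"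
  proof -
    have "L x (r + Suc K) (s p m) - s [:coeff p (Suc K):] (L x r m) =
        (s [:a:] (L x (Suc (r + K)) m) + s [:0, 1:] (L x (Suc (r + K)) (s q m))) +
        (L x (r + K) (s q m) - s [:coeff q K:] (L x r m))"
      using expand[of "r + K"] by (simp add: p)
    then show ?thesis using subspace_add[OF W lower[of "r + K"]] IH by simp
  qed
  ultimately show ?case by blast
qed

lemma L_downward_induct:
  assumes "subspace W" and "\<And>r. (\<And>j. j > r \<Longrightarrow> L x j m \<in> W) \<Longrightarrow> L x r m \<in> W"
  shows "L x j m \<in> W"
proof -
  obtain n where n: "\<And>j. j > n \<Longrightarrow> L x j m = 0" using L_eventually_0 by blast
  show ?thesis
  proof (induction "n - j" arbitrary: j rule: less_induct)
    case less
    show ?case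
    proof (rule assms(2))
      fix i assume "i > j"
      then show "L x i m \<in> W"
        using less[of i] n[of i] subspace_0[OF assms(1)] by (cases "i > n") auto
    qed
  qed
qed

text \<open>The leading coefficient of \<open>p\<close> is a nonzero constant and can be divided
  out. For invariant \<open>W\<close>, torsion elements of the quotient by \<open>W\<close> are thus
  annihilated by every \<open>L x j\<close>.\<close>

lemma L_mem_of_multiple:
  assumes W: "subspace W" and "p \<noteq> 0" and "\<And>j. L x j (s p m) \<in> W"
  shows "L x j m \<in> W"
proof (rule L_downward_induct[OF W])
  fix r assume "\<And>j. j > r \<Longrightarrow> L x j m \<in> W"
  from L_scale_leading[OF W this order_refl, where p = p]
  have 1: "L x (r + degree p) (s p m) - s [:lead_coeff p:] (L x r m) \<in> W" by simp
  from subspace_diff[OF W assms(3)[of "r + degree p"] 1]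
  have "s [:lead_coeff p:] (L x r m) \<in> W" by simp
  from subspace_scale[OF W this, of "[:inverse (lead_coeff p):]"] show "L x r m \<in> W"
    using \<open>p \<noteq> 0\<close> by (simp add: scale_scale flip: one_pCons)
qed

lemma L_torsion:
  assumes "m \<in> torsion" shows "L x j m = 0"
proof -
  obtain p where "p \<noteq> 0" "s p m = 0" using assms by (auto simp: torsion_def)
  then show ?thesis using L_mem_of_multiple[of "{0}" p x m j] by (simp add: L_zero)
qed

subsection \<open>The module endomorphism \<open>D\<close>\<close>

definition D :: "'m \<Rightarrow> 'm" where
  "D m = L 1 0 m - s [:0, 1:] m"

lemma additive_D: "additive D"
  by standard (simp add: D_def L_add scale_right_distrib)

lemmas D_add = additive.add[OF additive_D]
  and D_zero = additive.zero[OF additive_D]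
  and D_diff = additive.diff[OF additive_D]

lemma D_scale: "D (s p m) = s p (D m)"
proof -
  have "s [:0, 1:] (s p m) = s p (s [:0, 1:] m)" by (simp only: scale_scale mult.commute)
  then show ?thesis unfolding D_def by (simp only: L_0_scale scale_right_diff_distrib)
qed

text \<open>Both \<open>L 1 0\<close> and \<open>\<partial>\<close> have commutator \<open>- L x (j - 1)\<close> with \<open>L x j\<close>.\<close>

lemma L_D: "L x j (D m) = D (L x j m)"
proof (cases j)
  case 0
  then show ?thesis by (simp add: D_def L_diff L_del_0 comm_0)
next
  case (Suc i)
  then show ?thesis using comm_Suc[of 1 x i m] by (simp add: D_def L_diff L_del_Suc algebra_simps)
qed

text \<open>The elements annihilated by a product of operators \<open>D - c\<close> with \<open>c \<in> \<complex>\<close>.\<close>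

inductive_set Dtors :: "'m set" where
  zero: "0 \<in> Dtors"
| step: "D m - s [:c:] m \<in> Dtors \<Longrightarrow> m \<in> Dtors"

lemma Dtors_image:
  assumes "additive F" "\<And>m. F (D m) = D (F m)" "\<And>c m. F (s [:c:] m) = s [:c:] (F m)" "m \<in> Dtors"
  shows "F m \<in> Dtors"
  using assms(4)
proof induction
  case zero
  then show ?case using additive.zero[OF assms(1)] Dtors.zero by simp
next
  case (step m c)
  then show ?case using Dtors.step[of "F m" c] by (simp add: additive.diff[OF assms(1)] assms(2,3))
qed

lemma Dtors_scale: "m \<in> Dtors \<Longrightarrow> s p m \<in> Dtors"
  by (rule Dtors_image[where F = "s p"])
    (simp_all add: additive_def scale_right_distrib D_scale scale_commute)

lemma Dtors_D: "m \<in> Dtors \<Longrightarrow> D m \<in> Dtors"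
  by (rule Dtors_image[where F = D]) (simp_all add: additive_D D_scale)

lemma Dtors_add: "m \<in> Dtors \<Longrightarrow> n \<in> Dtors \<Longrightarrow> m + n \<in> Dtors"
proof (induction arbitrary: n rule: Dtors.induct)
  case (step m c)
  \<comment> \<open>The factor \<open>D - c\<close> has to be applied to both summands.\<close>
  have "D n - s [:c:] n \<in> Dtors"
    by (rule Dtors_image[where F = "\<lambda>n. D n - s [:c:] n"])
      (use step.prems in \<open>simp_all add: additive_def D_add D_diff D_scale scale_right_distrib
        scale_right_diff_distrib scale_commute\<close>)
  from step.IH[OF this] show ?case
    by (rule Dtors.step[of _ c, OF back_subst[of "\<lambda>v. v \<in> Dtors"]])
      (simp add: D_add scale_right_distrib add_diff_add)
qed simp

lemma Dtors_subspace: "subspace Dtors"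
  by (intro subspaceI Dtors.zero Dtors_add Dtors_scale)

lemma Dtors_D_power: "m \<in> Dtors \<Longrightarrow> (D ^^ k) m \<in> Dtors"
  by (induction k) (auto intro: Dtors_D)

lemma L_D_power: "L x j ((D ^^ k) m) = (D ^^ k) (L x j m)"
  by (induction k) (auto simp: L_D)

text \<open>A polynomial in \<open>D\<close> with constant coefficients splits into linear factors.\<close>

lemma Dtors_of_polynomial:
  assumes "r \<noteq> 0" "poly_subst D (\<lambda>c. s [:c:] m) r \<in> Dtors"
  shows "m \<in> Dtors"
  using assms
proof (induction "degree r" arbitrary: r m)
  case 0
  then obtain c where r: "r = [:c:]" using degree0_coeffs[of r] by auto
  then have "c \<noteq> 0" "s [:c:] m \<in> Dtors" using 0 by (auto simp: poly_subst_def)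
  from Dtors_scale[OF this(2), of "[:inverse c:]"] this(1) show ?case
    by (simp add: scale_scale flip: one_pCons)
next
  case (Suc n)
  then have "\<not> constant (poly r)" by (simp add: constant_degree)
  then obtain c where "poly r c = 0" using fundamental_theorem_of_algebra by blast
  then obtain q where r: "r = [:- c, 1:] * q" by (meson dvdE poly_eq_0_iff_dvd)
  then have q: "q \<noteq> 0" using Suc.prems by auto
  then have "degree r = Suc (degree q)" unfolding r by (subst degree_mult_eq) auto
  then have dq: "n = degree q" using Suc.hyps(2) by simp
  have add_s: "additive (\<lambda>c. s [:c:] m)" for m
    by standard (metis add_pCons add_0 scale_left_distrib)
  note bound = poly_subst_bound[OF additive_D add_s]
  \<comment> \<open>As \<open>r\<close> is (X - c) q, this and the next identity give r(D) m = q(D)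
    ((D - c) m).\<close>
  have "poly_subst D (\<lambda>c. s [:c:] m) (pCons 0 q) = poly_subst D (\<lambda>c. s [:c:] (D m)) q"
    using bound[of "pCons 0 q" "Suc n" m] bound[of q n "D m"] dq q
    by (simp add: sum.atMost_Suc_shift degree_pCons_le D_zero funpow_swap1 D_scale del: sum.atMost_Suc)
  moreover have "poly_subst D (\<lambda>c. s [:c:] m) (smult (- c) q) =
      poly_subst D (\<lambda>a. s [:a:] (s [:- c:] m)) q"
    unfolding poly_subst_def by (cases "c = 0") (auto simp: scale_scale mult.commute additive.zero[OF additive_funpow[OF additive_D]])
  moreover have "r = pCons 0 q + smult (- c) q" using r by simp
  ultimately have "poly_subst D (\<lambda>c. s [:c:] m) r =
      poly_subst D (\<lambda>c. s [:c:] (D m)) q + poly_subst D (\<lambda>a. s [:a:] (s [:- c:] m)) q"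
    by (simp only: additive.add[OF poly_subst_additive[OF additive_D add_s]])
  also have "\<dots> = poly_subst D (\<lambda>a. s [:a:] (D m + s [:- c:] m)) q"
    using additive.add[OF poly_subst_additive_fun[OF additive_D, of "\<lambda>m a. s [:a:] m" q]]
    by (simp add: additive_def scale_right_distrib)
  also have "D m + s [:- c:] m = D m - s [:c:] m"
    by (metis diff_conv_add_uminus minus_pCons neg_equal_zero scale_minus_left minus_zero)
  finally have "poly_subst D (\<lambda>a. s [:a:] (D m - s [:c:] m)) q \<in> Dtors"
    using Suc.prems by simp
  then have "D m - s [:c:] m \<in> Dtors" by (rule Suc.hyps(1)[OF dq q])
  then show ?case by (rule Dtors.step)
qed

text \<open>
  The top coefficient in \<open>\<lambda>\<close> of \<open>L\<^sub>x \<^sub>\<lambda>\<close> applied to a relation \<open>\<Sum>\<^sub>k q\<^sub>k(\<partial>) D^k m = 0\<close> is a polynomial in \<open>D\<close>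
  with constant coefficients.
\<close>

lemma L_mem_Dtors:
  assumes "finite_module s"
  shows "L x j m \<in> Dtors"
proof (rule L_downward_induct[OF Dtors_subspace])
  fix r assume small: "\<And>j. j > r \<Longrightarrow> L x j m \<in> Dtors"
  obtain G where G: "finite G" "span G = UNIV" using assms by (auto simp: finite_module_def)
  \<comment> \<open>The \<open>card G + 1\<close> elements m, D m, D^2 m, ... satisfy a relation
    over \<complex>[\<partial>].\<close>
  obtain q where q: "\<exists>k\<le>card G. q k \<noteq> 0" "(\<Sum>k\<le>card G. s (q k) ((D ^^ k) m)) = 0"
    using span_relation[OF G(1), of "{..card G}" "\<lambda>k. (D ^^ k) m"] G(2) by auto
  define K where "K = Max ((\<lambda>k. degree (q k)) ` {k. k \<le> card G \<and> q k \<noteq> 0})"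
  have fin: "finite {k. k \<le> card G \<and> q k \<noteq> 0}" by simp
  have K: "degree (q k) \<le> K" if "k \<le> card G" for k
    using that fin unfolding K_def by (cases "q k = 0") (auto intro!: Max_ge)
  obtain k0 where k0: "k0 \<le> card G" "q k0 \<noteq> 0" "K = degree (q k0)"
  proof -
    have "K \<in> (\<lambda>k. degree (q k)) ` {k. k \<le> card G \<and> q k \<noteq> 0}"
      unfolding K_def using q(1) fin by (intro Max_in) auto
    then show ?thesis using that by auto
  qed
  \<comment> \<open>The coefficients of \<lambda>^K in q_k(\<partial> + \<lambda>) are constants,
    and not all zero because \<open>K\<close> is the largest degree.\<close>
  define p where "p = (\<Sum>k\<le>card G. monom (coeff (q k) K) k)"
  have coeff_p: "coeff p k = (if k \<le> card G then coeff (q k) K else 0)" for k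
    by (simp add: p_def coeff_sum)
  have "p \<noteq> 0" using coeff_p[of k0] k0 by auto
  moreover have "poly_subst D (\<lambda>c. s [:c:] (L x r m)) p \<in> Dtors"
  proof -
    have "L x (r + K) (s (q k) ((D ^^ k) m)) - s [:coeff (q k) K:] ((D ^^ k) (L x r m)) \<in> Dtors"
      if "k \<le> card G" for k
      using L_scale_leading[OF Dtors_subspace _ K[OF that], of r x "(D ^^ k) m"] small
      by (simp add: L_D_power Dtors_D_power)
    then have "(\<Sum>k\<le>card G. L x (r + K) (s (q k) ((D ^^ k) m)) -
        s [:coeff (q k) K:] ((D ^^ k) (L x r m))) \<in> Dtors"
      by (intro subspace_sum[OF Dtors_subspace]) simp
    also have "(\<Sum>k\<le>card G. L x (r + K) (s (q k) ((D ^^ k) m)) -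
        s [:coeff (q k) K:] ((D ^^ k) (L x r m))) =
        - (\<Sum>k\<le>card G. s [:coeff (q k) K:] ((D ^^ k) (L x r m)))"
      by (simp add: sum_subtractf L_sum[symmetric] q(2) L_zero)
    finally have *: "(\<Sum>k\<le>card G. s [:coeff (q k) K:] ((D ^^ k) (L x r m))) \<in> Dtors"
      using subspace_neg[OF Dtors_subspace] by fastforce
    have add_s: "additive (\<lambda>c. s [:c:] m)" for m
      by standard (metis add_pCons add_0 scale_left_distrib)
    have pow: "(D ^^ i) (s [:a:] m) = s [:a:] ((D ^^ i) m)" for a i m
      by (induction i) (auto simp: D_scale)
    have "degree p \<le> card G" by (rule degree_le) (simp add: coeff_p)
    from poly_subst_bound[OF additive_D add_s this] * show ?thesis
      by (simp add: pow coeff_p)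
  qed
  ultimately show "L x r m \<in> Dtors" by (rule Dtors_of_polynomial)
qed

text \<open>When the factors \<open>D - c\<close> are applied one after another, the last nonzero
  vector is an eigenvector.\<close>

lemma Dtors_eigenvector:
  assumes "m \<in> Dtors" "m \<noteq> 0"
  shows "\<exists>v c. v \<noteq> 0 \<and> D v = s [:c:] v"
  using assms
proof induction
  case (step m c)
  then show ?case by (cases "D m - s [:c:] m = 0") auto
qed simp

text \<open>
  On the kernel of \<open>L 1 0 = \<partial> + D\<close> the operator \<open>D - c\<close> is \<open>- (\<partial> + c)\<close>, which can be cancelled
  modulo torsion.
\<close>

lemma Dtors_L_1_0_torsion:
  assumes "m \<in> Dtors" "L 1 0 m \<in> torsion"
  shows "m \<in> torsion"
  using assms
proof induction
  case zero
  then show ?case using subspace_0[OF torsion_subspace] by simp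
next
  case (step m c)
  have "L 1 0 (D m - s [:c:] m) = L 1 0 (L 1 0 m) - s [:c, 1:] (L 1 0 m)"
    by (simp add: L_diff L_0_scale D_def scale_linear[of c])
  then have "L 1 0 (D m - s [:c:] m) \<in> torsion"
    using step.prems by (simp add: L_torsion L_zero subspace_neg subspace_scale torsion_subspace)
  then have "D m - s [:c:] m \<in> torsion" by (rule step.IH)
  from subspace_diff[OF torsion_subspace step.prems this]
  have "s [:c, 1:] m \<in> torsion" by (simp add: D_def scale_linear[of c] algebra_simps)
  then show ?case by (rule torsion_cancel[rotated]) simp
qed


subsection \<open>Existence of irreducible submodules\<close>

definition invariant :: "'m set \<Rightarrow> bool" where
  "invariant N \<longleftrightarrow> subspace N \<and> (\<forall>x j. \<forall>n\<in>N. L x j n \<in> N)"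

lemma invariant_eigenspace: "invariant {m. D m = s [:c:] m}"
  unfolding invariant_def
  by (auto intro!: subspaceI
      simp: D_zero D_add scale_right_distrib D_scale scale_commute L_D[symmetric] L_const)

text \<open>The rank is the largest size of an independent subset, and \<open>P\<close> is chosen
  with least rank. If no nonzero multiple of \<open>m\<close> lay in \<open>P'\<close>, adding
  \<open>m\<close> to a largest independent subset of \<open>P'\<close> would give \<open>P\<close>
  a larger rank than \<open>P'\<close>.\<close>

lemma ex_invariant_no_smaller_rank:
  assumes "finite_module s" "invariant N" "N \<noteq> {0}"
  shows "\<exists>P\<subseteq>N. invariant P \<and> P \<noteq> {0} \<and>
    (\<forall>P'\<subseteq>P. invariant P' \<and> P' \<noteq> {0} \<longrightarrow> (\<forall>m\<in>P. \<exists>p. p \<noteq> 0 \<and> s p m \<in> P'))"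
proof -
  obtain G where G: "finite G" "span G = UNIV" using assms by (auto simp: finite_module_def)
  define ranks where "ranks P = {card S |S. S \<subseteq> P \<and> independent S}" for P
  have ranks: "finite (ranks P)" "ranks P \<noteq> {}" for P
  proof -
    have "ranks P \<subseteq> {..card G}"
      unfolding ranks_def using independent_card_le[OF G(1)] G(2) by auto
    then show "finite (ranks P)" by (rule finite_subset) simp
    show "ranks P \<noteq> {}" unfolding ranks_def using independent_empty by blast
  qed
  define Q where "Q P \<longleftrightarrow> P \<subseteq> N \<and> invariant P \<and> P \<noteq> {0}" for P
  have "Q N" using assms by (simp add: Q_def)
  then obtain P where P: "Q P" and least: "\<And>P'. Q P' \<Longrightarrow> Max (ranks P) \<le> Max (ranks P')"
    using arg_min_nat_lemma[of Q N "\<lambda>P. Max (ranks P)"] by blast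
  have "\<exists>p. p \<noteq> 0 \<and> s p m \<in> P'" if P': "P' \<subseteq> P" "invariant P'" "P' \<noteq> {0}" and m: "m \<in> P" for P' m
  proof (rule ccontr)
    assume no: "\<not> ?thesis"
    have "Max (ranks P') \<in> ranks P'" by (rule Max_in[OF ranks])
    then obtain S where S: "S \<subseteq> P'" "independent S" "card S = Max (ranks P')"
      by (auto simp: ranks_def)
    have fin: "finite S" using independent_card_le[OF G(1) _ S(2)] G(2) by auto
    have sub: "subspace P'" using P'(2) by (simp add: invariant_def)
    have mS: "m \<notin> S" using no S(1) by (metis scale_one subsetD zero_neq_one)
    have "independent (insert m S)"
    proof
      assume "dependent (insert m S)"
      then obtain u v where u: "(\<Sum>v\<in>insert m S. s (u v) v) = 0" "v \<in> insert m S" "u v \<noteq> 0"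
        using dependent_finite[of "insert m S"] fin by auto
      have eq: "s (u m) m = - (\<Sum>v\<in>S. s (u v) v)"
        using u(1) fin mS by (simp add: eq_neg_iff_add_eq_0)
      also have "\<dots> \<in> P'"
        using S(1) by (intro subspace_neg[OF sub] subspace_sum[OF sub] subspace_scale[OF sub]) auto
      finally have 0: "u m = 0" using no by blast
      then have "v \<in> S" "(\<Sum>v\<in>S. s (u v) v) = 0" using eq u by auto
      then show False using independentD[OF S(2) fin order_refl] u(3) by blast
    qed
    moreover have "insert m S \<subseteq> P" using S(1) P'(1) m by blast
    ultimately have "Suc (card S) \<in> ranks P"
      unfolding ranks_def using fin mS
      by (metis (mono_tags, lifting) card_insert_disjoint mem_Collect_eq)
    then have "Suc (card S) \<le> Max (ranks P)" using ranks by simp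
    also have "\<dots> \<le> Max (ranks P')" using P P' by (intro least) (auto simp: Q_def)
    finally show False using S(3) by simp
  qed
  then show ?thesis using P unfolding Q_def by blast
qed

lemma ex_irreducible:
  assumes fin: "finite_module s" and free: "torsion = {0}" and "L x j m \<noteq> 0"
  shows "\<exists>N. invariant N \<and> (\<forall>N'. invariant N' \<and> N' \<subseteq> N \<longrightarrow> N' = {0} \<or> N' = N) \<and>
    (\<exists>n\<in>N. L 1 0 n \<noteq> 0)"
proof -
  obtain v c where v: "v \<noteq> 0" "D v = s [:c:] v"
    using Dtors_eigenvector[OF L_mem_Dtors[OF fin] assms(3)] by blast
  define E where "E = {m. D m = s [:c:] m}"
  have "E \<noteq> {0}" using v by (auto simp: E_def)
  with ex_invariant_no_smaller_rank[OF fin invariant_eigenspace] obtain P where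
    P: "P \<subseteq> E" "invariant P" "P \<noteq> {0}" and
    cotorsion: "\<And>P' m. P' \<subseteq> P \<Longrightarrow> invariant P' \<Longrightarrow> P' \<noteq> {0} \<Longrightarrow> m \<in> P \<Longrightarrow> \<exists>p. p \<noteq> 0 \<and> s p m \<in> P'"
    unfolding E_def by meson
  have L: "L 1 0 n = s [:c, 1:] n" if "n \<in> P" for n
    using that P(1) unfolding E_def by (auto simp: D_def scale_linear[of c] algebra_simps)
  have nz: "s [:c, 1:] n \<noteq> 0" if "n \<noteq> 0" for n
    using that free unfolding torsion_def
    by (metis (mono_tags, lifting) mem_Collect_eq pCons_eq_0_iff singletonD zero_neq_one)
  text \<open>\<open>L 1 0\<close> acts as zero on the torsion module \<open>P / P'\<close>, and as \<open>\<partial> + c\<close> on \<open>P\<close>.\<close>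
  have contains: "s [:c, 1:] n \<in> P'"
    if P': "P' \<subseteq> P" "invariant P'" "P' \<noteq> {0}" and n: "n \<in> P" for P' n
  proof -
    obtain p where "p \<noteq> 0" "s p n \<in> P'" using cotorsion[OF P' n] by blast
    then show ?thesis
      using L_mem_of_multiple[of P' p 1 n 0] P'(2) L[OF n] by (auto simp: invariant_def)
  qed
  define F where "F = {P'. P' \<subseteq> P \<and> invariant P' \<and> P' \<noteq> {0}}"
  have "P \<in> F" using P by (simp add: F_def)
  have inv: "invariant (\<Inter>F)"
    unfolding invariant_def
    using subspace_Inter[of F] by (auto simp: F_def invariant_def)
  have "0 \<in> P" using P(2) subspace_0 by (auto simp: invariant_def)
  then obtain n where n: "n \<in> P" "n \<noteq> 0" using P(3) by blast
  \<comment> \<open>This element witnesses nontriviality: \<open>L 1 0\<close> sends it to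
    (\<partial> + c)^2 n, which is nonzero in the absence of torsion.\<close>
  have N: "s [:c, 1:] n \<in> \<Inter>F" using contains n(1) by (auto simp: F_def)
  have "L 1 0 (s [:c, 1:] n) \<noteq> 0"
    using L[of "s [:c, 1:] n"] N \<open>P \<in> F\<close> nz n(2) by auto
  moreover have "N' = {0} \<or> N' = \<Inter>F" if "invariant N'" "N' \<subseteq> \<Inter>F" for N'
  proof (cases "N' = {0}")
    case False
    then have "N' \<in> F" using that \<open>P \<in> F\<close> by (auto simp: F_def)
    then show ?thesis using that(2) by blast
  qed simp
  ultimately show ?thesis using inv N by blast
qed

end


subsection \<open>Finite-dimensionality of the coefficient algebra\<close>

locale virasoro_operators_linear = virasoro_operators s L + A: vector_space sc
  for s :: "complex poly \<Rightarrow> 'm::ab_group_add \<Rightarrow> 'm"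
    and L :: "'a::{comm_ring, comm_monoid_mult} \<Rightarrow> nat \<Rightarrow> 'm \<Rightarrow> 'm"
    and sc :: "complex \<Rightarrow> 'a \<Rightarrow> 'a" +
  assumes L_add_left: "L (x + y) j m = L x j m + L y j m"
    and L_sc: "L (sc c x) j m = s [:c:] (L x j m)"
begin

lemma L_sum_left: "L (\<Sum>i\<in>I. sc (c i) (x i)) j m = (\<Sum>i\<in>I. s [:c i:] (L (x i) j m))"
proof -
  have "additive (\<lambda>x. L x j m)" by standard (rule L_add_left)
  then show ?thesis by (simp add: additive.sum[where f = "\<lambda>x. L x j m"] L_sc)
qed

text \<open>The commutator with \<open>L 1 (Suc j)\<close> recovers \<open>L x j\<close> from
  \<open>L x 0\<close>.\<close>

lemma L_0_determines:
  assumes "\<And>m. L x 0 m = 0" shows "L x j m = 0"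
  using comm_Suc[of x 1 j m] by (simp add: assms L_zero)

lemma relation_eq_0:
  assumes "span G = UNIV" "\<And>g. g \<in> G \<Longrightarrow> (\<Sum>i\<in>I. s (p i) (L (x i) 0 g)) = 0"
  shows "(\<Sum>i\<in>I. s (p i) (L (x i) 0 m)) = 0"
proof -
  let ?F = "\<lambda>m. \<Sum>i\<in>I. s (p i) (L (x i) 0 m)"
  have "?F (s q m) = s q (?F m)" for q m
    by (simp add: L_0_scale scale_sum_right scale_commute)
  then have "subspace {m. ?F m = 0}"
    by (intro subspaceI) (auto simp: L_zero L_add scale_right_distrib sum.distrib)
  then have "span G \<subseteq> {m. ?F m = 0}" using assms(2) by (intro span_minimal) auto
  then show ?thesis using assms(1) by blast
qed

text \<open>\<open>L 1 1\<close> kills the torsion sum, and its commutator with p(\<partial>) is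
  p'(\<partial>) \<open>L 1 0\<close>. Hence \<open>L 1 0\<close> sends the differentiated sum into
  torsion, and it can be cancelled because that sum lies in \<open>Dtors\<close>.\<close>

lemma relation_pderiv:
  assumes fin: "finite_module s"
    and rel: "\<And>m. (\<Sum>i\<in>I. s (p i) (L (x i) 0 m)) \<in> torsion"
  shows "(\<Sum>i\<in>I. s (pderiv (p i)) (L (x i) 0 m)) \<in> torsion"
proof -
  let ?t = "\<lambda>m. \<Sum>i\<in>I. s (p i) (L (x i) 0 m)" and ?y = "\<Sum>i\<in>I. s (pderiv (p i)) (L (x i) 0 m)"
  have weight: "L 1 1 (L z 0 m) = L z 0 (L 1 1 m) + L z 0 m" for z
    using comm_Suc[of z 1 0 m] by (simp add: algebra_simps)
  have "0 = L 1 1 (?t m)" using L_torsion[OF rel] by simp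
  also have "\<dots> = (\<Sum>i\<in>I. s (p i) (L (x i) 0 (L 1 1 m)) + s (p i) (L (x i) 0 m) +
      L 1 0 (s (pderiv (p i)) (L (x i) 0 m)))"
    unfolding L_sum L_1_scale weight scale_right_distrib L_0_scale ..
  also have "\<dots> = ?t (L 1 1 m) + ?t m + L 1 0 ?y"
    by (simp add: sum.distrib L_sum)
  finally have "?t (L 1 1 m) + ?t m + L 1 0 ?y = 0" ..
  then have "L 1 0 ?y = - (?t (L 1 1 m) + ?t m)" by (simp only: add_eq_0_iff)
  then have "L 1 0 ?y \<in> torsion"
    using subspace_neg[OF torsion_subspace subspace_add[OF torsion_subspace rel rel]] by simp
  moreover have "?y \<in> Dtors"
    by (intro subspace_sum[OF Dtors_subspace] Dtors_scale L_mem_Dtors[OF fin])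
  ultimately show ?thesis by (rule Dtors_L_1_0_torsion[rotated])
qed

text \<open>Differentiate as long as some derivative is nonzero; in characteristic 0 the remaining
  coefficients are constants.\<close>

lemma relation_constant:
  assumes fin: "finite_module s"
    and "\<And>m. (\<Sum>i\<in>I. s (p i) (L (x i) 0 m)) \<in> torsion" and "\<exists>i\<in>I. p i \<noteq> 0"
    and "\<And>i. i \<in> I \<Longrightarrow> degree (p i) \<le> K"
  shows "\<exists>c. (\<exists>i\<in>I. c i \<noteq> 0) \<and> (\<forall>m. L (\<Sum>i\<in>I. sc (c i) (x i)) 0 m \<in> torsion)"
  using assms(2-)
proof (induction K arbitrary: p)
  let ?goal = "\<exists>c. (\<exists>i\<in>I. c i \<noteq> 0) \<and> (\<forall>m. L (\<Sum>i\<in>I. sc (c i) (x i)) 0 m \<in> torsion)"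
  have const: ?goal if "\<And>i. i \<in> I \<Longrightarrow> degree (p i) = 0"
    "\<And>m. (\<Sum>i\<in>I. s (p i) (L (x i) 0 m)) \<in> torsion" "\<exists>i\<in>I. p i \<noteq> 0" for p
  proof -
    have p: "p i = [:coeff (p i) 0:]" if "i \<in> I" for i
      using degree0_coeffs[of "p i"] \<open>\<And>i. i \<in> I \<Longrightarrow> degree (p i) = 0\<close>[OF that] by auto
    have "(\<Sum>i\<in>I. s (p i) (L (x i) 0 m)) = L (\<Sum>i\<in>I. sc (coeff (p i) 0) (x i)) 0 m" for m
      unfolding L_sum_left using p by (intro sum.cong) auto
    moreover have "\<exists>i\<in>I. coeff (p i) 0 \<noteq> 0" using that(3) p by (metis pCons_0_0)
    ultimately show ?thesis using that(2) by (intro exI[of _ "\<lambda>i. coeff (p i) 0"]) simp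
  qed
  {
    case 0
    then show ?case using const[of p] by simp
  next
    case (Suc K)
    show ?case
    proof (cases "\<exists>i\<in>I. pderiv (p i) \<noteq> 0")
      case True
      show ?thesis
      proof (rule Suc.IH[OF _ True])
        show "(\<Sum>i\<in>I. s (pderiv (p i)) (L (x i) 0 m)) \<in> torsion" for m
          by (rule relation_pderiv[OF fin Suc.prems(1)])
        show "degree (pderiv (p i)) \<le> K" if "i \<in> I" for i
          using Suc.prems(3)[OF that] by (simp add: degree_pderiv)
      qed
    next
      case False
      then have "degree (p i) = 0" if "i \<in> I" for i using that by (simp add: pderiv_eq_0_iff)
      then show ?thesis using const[of p] Suc.prems by blast
    qed
  }
qed

text \<open>A vanishing combination over \<complex>[\<partial>] costs one equation for each pair of
  generators, one as argument and one for the coordinate of the value.\<close>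

lemma combination_into_torsion:
  assumes fin: "finite_module s" and G: "finite G" "span G = UNIV" and "finite I"
    and card: "card (G \<times> G) < card I"
  shows "\<exists>c. (\<exists>i\<in>I. c i \<noteq> 0) \<and> (\<forall>m. L (\<Sum>i\<in>I. sc (c i) (x i)) 0 m \<in> torsion)"
proof -
  have "\<forall>m. \<exists>c. m = (\<Sum>h\<in>G. s (c h) h)" using span_finite_coeffs[OF G(1)] G(2) by simp
  then obtain a where a: "\<And>m. m = (\<Sum>h\<in>G. s (a m h) h)" by metis
  obtain q where q: "\<exists>i\<in>I. q i \<noteq> 0"
    "\<And>g h. g \<in> G \<Longrightarrow> h \<in> G \<Longrightarrow> (\<Sum>i\<in>I. q i * a (L (x i) 0 g) h) = 0"
    using homogeneous_system_nontrivial_solution[OF _ \<open>finite I\<close> card,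
        of "\<lambda>i (g, h). a (L (x i) 0 g) h"] G(1) by auto
  have "(\<Sum>i\<in>I. s (q i) (L (x i) 0 g)) = 0" if "g \<in> G" for g
  proof -
    have "(\<Sum>i\<in>I. s (q i) (L (x i) 0 g)) =
        (\<Sum>i\<in>I. s (q i) (\<Sum>h\<in>G. s (a (L (x i) 0 g) h) h))"
      using a by (intro sum.cong arg_cong2[where f = s]) auto
    also have "\<dots> = (\<Sum>h\<in>G. s (\<Sum>i\<in>I. q i * a (L (x i) 0 g) h) h)"
      unfolding scale_sum_right scale_sum_left scale_scale by (rule sum.swap)
    also have "\<dots> = 0" using q(2)[OF that] by simp
    finally show ?thesis .
  qed
  from relation_eq_0[OF G(2) this]
  have "(\<Sum>i\<in>I. s (q i) (L (x i) 0 m)) \<in> torsion" for m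
    using subspace_0[OF torsion_subspace] by simp
  moreover have "degree (q i) \<le> Max ((\<lambda>i. degree (q i)) ` I)" if "i \<in> I" for i
    using that \<open>finite I\<close> by (intro Max_ge) auto
  ultimately show ?thesis by (rule relation_constant[OF fin _ q(1)])
qed

text \<open>The values now lie in a space spanned over \<complex> by \<open>H\<close>, so the same
  count works with constant coefficients.\<close>

lemma combination_to_0:
  assumes G: "finite G" "span G = UNIV" and H: "finite H"
    and span: "\<And>t. t \<in> torsion \<Longrightarrow> \<exists>c. t = (\<Sum>h\<in>H. s [:c h:] h)"
    and "finite I" and card: "card (G \<times> H) < card I"
    and z: "\<And>i m. i \<in> I \<Longrightarrow> L (z i) 0 m \<in> torsion"
  shows "\<exists>c. (\<exists>i\<in>I. c i \<noteq> 0) \<and> (\<forall>m. L (\<Sum>i\<in>I. sc (c i) (z i)) 0 m = 0)"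
proof -
  obtain a where a: "\<And>t. t \<in> torsion \<Longrightarrow> t = (\<Sum>h\<in>H. s [:a t h:] h)" using span by metis
  obtain q where q: "\<exists>i\<in>I. q i \<noteq> 0"
    "\<And>g h. g \<in> G \<Longrightarrow> h \<in> H \<Longrightarrow> (\<Sum>i\<in>I. q i * a (L (z i) 0 g) h) = 0"
    using homogeneous_system_nontrivial_solution[OF _ \<open>finite I\<close> card,
        of "\<lambda>i (g, h). a (L (z i) 0 g) h"] G(1) H by auto
  have "(\<Sum>i\<in>I. s [:q i:] (L (z i) 0 g)) = 0" if "g \<in> G" for g
  proof -
    have const: "(\<Sum>i\<in>I. [:f i:]) = [:\<Sum>i\<in>I. f i:]" for f :: "_ \<Rightarrow> complex"
      using additive.sum[OF additive_const_poly(1), of f I] by simp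
    have "(\<Sum>i\<in>I. s [:q i:] (L (z i) 0 g)) =
        (\<Sum>i\<in>I. s [:q i:] (\<Sum>h\<in>H. s [:a (L (z i) 0 g) h:] h))"
      using a z by (intro sum.cong arg_cong2[where f = s]) auto
    also have "\<dots> = (\<Sum>h\<in>H. s (\<Sum>i\<in>I. [:q i * a (L (z i) 0 g) h:]) h)"
      unfolding scale_sum_right scale_sum_left scale_scale
      by (subst sum.swap) (simp add: mult.commute)
    also have "\<dots> = 0" using q(2)[OF that] by (simp add: const)
    finally show ?thesis .
  qed
  from relation_eq_0[OF G(2) this] show ?thesis
    using q(1) by (intro exI[of _ q]) (simp add: L_sum_left)
qed

lemma finite_dim_of_faithful:
  assumes fin: "finite_module s" and faithful: "\<And>x. (\<And>j m. L x j m = 0) \<Longrightarrow> x = 0"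
  shows "\<exists>B. finite B \<and> A.span B = UNIV"
proof (rule ccontr)
  assume inf: "\<not> ?thesis"
  obtain B where "A.independent B" "UNIV \<subseteq> A.span B"
    by (rule A.maximal_independent_subset[of UNIV])
  then have B: "A.independent B" "A.span B = UNIV" by auto
  then have "infinite B" using inf by blast
  from infinite_countable_subset[OF this] obtain f :: "nat \<Rightarrow> 'a"
    where f: "inj f" "range f \<subseteq> B" by blast
  \<comment> \<open>An infinite array of distinct basis vectors: each row yields one combination
    acting into torsion, and a combination of rows then acts as zero.\<close>
  define x where "x = f \<circ> prod_encode"
  have x: "inj x" "range x \<subseteq> B" using f by (auto simp: x_def inj_compose inj_prod_encode)
  obtain G where G: "finite G" "span G = UNIV" using fin by (auto simp: finite_module_def)
  obtain H where H: "finite H" "\<And>t. t \<in> torsion \<Longrightarrow> \<exists>c. t = (\<Sum>h\<in>H. s [:c h:] h)"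
    using torsion_finite_dim[OF fin] by blast
  define I where "I = {..card (G \<times> G)}"
  define J where "J = {..card (G \<times> H)}"
  have "\<forall>j. \<exists>c. (\<exists>i\<in>I. c i \<noteq> 0) \<and> (\<forall>m. L (\<Sum>i\<in>I. sc (c i) (x (j, i))) 0 m \<in> torsion)"
    by (intro allI combination_into_torsion[OF fin G]) (auto simp: I_def)
  then obtain c where c: "\<And>j. \<exists>i\<in>I. c j i \<noteq> 0"
    "\<And>j m. L (\<Sum>i\<in>I. sc (c j i) (x (j, i))) 0 m \<in> torsion" by metis
  obtain d where d: "\<exists>j\<in>J. d j \<noteq> 0"
    "\<And>m. L (\<Sum>j\<in>J. sc (d j) (\<Sum>i\<in>I. sc (c j i) (x (j, i)))) 0 m = 0"
    using combination_to_0[OF G H, of J "\<lambda>j. \<Sum>i\<in>I. sc (c j i) (x (j, i))"] c(2)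
    by (auto simp: J_def)
  define u where "u v = (case inv x v of (j, i) \<Rightarrow> d j * c j i)" for v
  have "0 = (\<Sum>j\<in>J. sc (d j) (\<Sum>i\<in>I. sc (c j i) (x (j, i))))"
    using faithful[OF L_0_determines[OF d(2)]] by simp
  also have "\<dots> = (\<Sum>(j, i)\<in>J \<times> I. sc (d j * c j i) (x (j, i)))"
    by (simp add: A.scale_sum_right sum.cartesian_product)
  also have "\<dots> = (\<Sum>v\<in>x ` (J \<times> I). sc (u v) v)"
    using x(1) by (subst sum.reindex) (auto simp: u_def inj_on_def inj_def intro!: sum.cong)
  finally have zero: "(\<Sum>v\<in>x ` (J \<times> I). sc (u v) v) = 0" ..
  obtain j i where ji: "j \<in> J" "d j \<noteq> 0" "i \<in> I" "c j i \<noteq> 0" using c(1) d(1) by blast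
  have "u (x (j, i)) = 0"
    using ji x(2) by (intro A.independentD[OF B(1) _ _ zero]) (auto simp: I_def J_def)
  then show False using ji x(1) by (simp add: u_def)
qed

end


section \<open>Modules over the map Virasoro Lie conformal algebra\<close>

lemma coeff_lam_times: "coeff (lam_times q) j = pCons 0 (coeff q j)"
  by (simp add: lam_times_def coeff_map_poly)

text \<open>At \<lambda> = 0 only the constant term of the substitution survives.\<close>

lemma coeff_0_poly_subst_lam_times:
  "coeff (coeff (poly_subst lam_times f p) j) 0 =
    coeff (coeff (f (coeff p 0) :: 'm::ab_group_add poly poly) j) 0"
proof -
  have "coeff (coeff (poly_subst lam_times f p) j) 0 =
      (\<Sum>i\<le>degree p. coeff (coeff ((lam_times ^^ i) (f (coeff p i))) j) 0)"
    by (simp add: poly_subst_def coeff_sum)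
  also have "\<dots> = coeff (coeff (f (coeff p 0)) j) 0"
    by (simp add: sum.atMost_shift coeff_lam_times)
  finally show ?thesis .
qed

lemma coeff_at_lam_plus_mu_0: "coeff (coeff (at_lam_plus_mu p) j) 0 = coeff p j"
proof -
  define ev where "ev = map_poly (\<lambda>q :: 'a poly. coeff q 0)"
  have ev: "additive ev" unfolding ev_def by (intro map_poly_additive) (simp add: additive_def)
  have "ev (at_lam_plus_mu p) = poly_subst (pCons 0) (\<lambda>c. [:c:]) (map_poly (\<lambda>c. c) p)"
    unfolding at_lam_plus_mu_def
  proof (rule poly_subst_map[OF ev])
    show "ev (lam_times q + mu_times q) = pCons 0 (ev q)" for q
      by (rule poly_eqI)
        (simp add: ev_def coeff_map_poly coeff_lam_times mu_times_def coeff_pCons split: nat.split)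
  qed (simp_all add: additive_def ev_def map_poly_pCons)
  also have "\<dots> = p"
  proof -
    have "(pCons 0 ^^ i) [:c:] = monom c i" for i and c :: 'a
      by (induction i) (simp_all add: monom_0 monom_Suc)
    then show ?thesis by (simp add: poly_subst_def poly_as_sum_of_monoms)
  qed
  finally have "coeff (ev (at_lam_plus_mu p)) j = coeff p j" by simp
  then show ?thesis by (simp add: ev_def coeff_map_poly)
qed

context unital_comm_algebra
begin

lemma tensor_1: "tensor sc 1 x = [:x:]"
  using tensor_monom[of 0 x] by (simp add: monom_0 one_pCons)

lemma map_vir_del: "map_vir_scale sc [:0, 1:] f = pCons 0 f"
proof (rule additive_eqI[OF map_vir_scale_additive additive_pCons0])
  show "map_vir_scale sc [:0, 1:] (tensor sc p x) = pCons 0 (tensor sc p x)" for p x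
    by (rule poly_eqI) (simp add: tensor_coeff coeff_pCons split: nat.split)
qed

end

locale map_vir_conformal_module =
  A: unital_comm_algebra sc + C: conformal_module "map_vir_scale sc" "map_vir_bracket sc" sM act
  for sc :: "complex \<Rightarrow> 'a::{comm_ring, comm_monoid_mult} \<Rightarrow> 'a"
    and sM :: "complex poly \<Rightarrow> 'm::ab_group_add \<Rightarrow> 'm" and act
begin

text \<open>\<open>[:x:]\<close> encodes \<open>L_x\<close>, by \<open>tensor_1\<close>.\<close>

definition L :: "'a \<Rightarrow> nat \<Rightarrow> 'm \<Rightarrow> 'm" where
  "L x j m = coeff (act [:x:] m) j"

lemma act_add: "act a (m + n) = act a m + act a n"
  "act (a + b) m = act a m + act b m"
  using C.act_linear_right C.act_linear_left by (auto simp: Vector_Spaces.linear_iff)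

lemma coeff_act_const:
  "coeff (act a (sM [:c:] m)) j = sM [:c:] (coeff (act a m) j)"
  "coeff (act (map_poly (sc c) a) m) j = sM [:c:] (coeff (act a m) j)"
proof -
  have "act a (cscale sM c m) = cscale_poly sM c (act a m)"
    "act (cscale (map_vir_scale sc) c a) m = cscale_poly sM c (act a m)"
    using C.act_linear_right C.act_linear_left by (auto simp: Vector_Spaces.linear_iff)
  then show "coeff (act a (sM [:c:] m)) j = sM [:c:] (coeff (act a m) j)"
    "coeff (act (map_poly (sc c) a) m) j = sM [:c:] (coeff (act a m) j)"
    by (simp_all add: A.cscale_map_vir cscale_poly_def coeff_map_poly cscale_def)
qed

lemma act_zero: "act 0 m = 0" "act a 0 = 0"
  using act_add(1)[of a 0 0] act_add(2)[of 0 0 m] by auto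

text \<open>Left sesquilinearity reduces the action of the whole algebra to that of the elements
  \<open>L_x\<close>.\<close>

lemma act_pCons: "act (pCons x a) m = act [:x:] m - pCons 0 (act a m)"
proof -
  have "pCons x a = [:x:] + map_vir_scale sc [:0, 1:] a" by (simp add: A.map_vir_del)
  then show ?thesis by (simp only: act_add C.act_del_left) simp
qed

text \<open>At \<lambda> = 0 the bracket of \<open>L_x\<close> and \<open>L_y\<close> contributes
  \<partial> \<open>L_(xy)\<close>, and this \<partial> acts as - (\<lambda> + \<mu>), that is, as -
  \<mu>.\<close>

lemma jacobi_0:
  "L x 0 (L y j m) - L y j (L x 0 m) = - coeff (pCons 0 (act [:x * y:] m)) j"
proof -
  let ?c = "\<lambda>q. coeff (coeff q j) 0"
  have "?c (act_lam_mu act [:x:] [:y:] m) = L x 0 (L y j m)"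
    by (simp add: act_lam_mu_def L_def coeff_map_poly act_zero)
  moreover have "?c (act_mu_lam act [:y:] [:x:] m) = L y j (L x 0 m)"
    by (simp add: act_mu_lam_def coeff_0_poly_subst_lam_times at_mu_def coeff_map_poly L_def)
  moreover have "?c (act_bracket (map_vir_bracket sc) act [:x:] [:y:] m) =
      - coeff (pCons 0 (act [:x * y:] m)) j"
    unfolding act_bracket_def coeff_0_poly_subst_lam_times coeff_at_lam_plus_mu_0
    using A.map_vir_bracket_L[of x y] C.act_del_left[of "[:x * y:]" m]
    by (cases j) (simp_all add: A.tensor_1)
  ultimately show ?thesis
    using arg_cong[OF C.act_jacobi[of "[:x:]" "[:y:]" m], of ?c] by (simp add: algebra_simps)
qed

sublocale O: virasoro_operators_linear sM L sc
proof
  fix x y :: 'a and m n :: 'm and j :: nat and c :: complex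
  show "L x j (m + n) = L x j m + L x j n" by (simp add: L_def act_add)
  show "L x j (sM [:c:] m) = sM [:c:] (L x j m)" by (simp add: L_def coeff_act_const)
  show "L x 0 (sM [:0, 1:] m) = sM [:0, 1:] (L x 0 m)"
    by (simp add: L_def C.act_del_right coeff_map_poly)
  show "L x (Suc j) (sM [:0, 1:] m) = sM [:0, 1:] (L x (Suc j) m) + L x j m"
    by (simp add: L_def C.act_del_right coeff_map_poly)
  show "L x 0 (L y 0 m) = L y 0 (L x 0 m)"
    using jacobi_0[of x y 0 m] by simp
  show "L x 0 (L y (Suc j) m) - L y (Suc j) (L x 0 m) = - L (x * y) j m"
    using jacobi_0[of x y "Suc j" m] by (simp add: L_def)
  show "\<exists>n. \<forall>j>n. L x j m = 0" unfolding L_def by (metis coeff_eq_0)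
  show "L (x + y) j m = L x j m + L y j m"
    using act_add(2)[of "[:x:]" "[:y:]" m] by (simp add: L_def)
  show "L (sc c x) j m = sM [:c:] (L x j m)"
    using coeff_act_const(2)[of c "[:x:]" m j] by (simp add: L_def map_poly_pCons)
qed

lemma coeff_act_mem:
  assumes N: "C.M.subspace N" and L: "\<And>x j. L x j m \<in> N"
  shows "coeff (act a m) i \<in> N"
proof (induction a arbitrary: i)
  case 0
  then show ?case using C.M.subspace_0[OF N] by (simp add: act_zero)
next
  case (pCons x a)
  have "coeff (pCons 0 (act a m)) i \<in> N"
    using pCons C.M.subspace_0[OF N] by (cases i) auto
  then show ?case
    unfolding act_pCons[of x a] coeff_diff
    by (intro C.M.subspace_diff[OF N] L[unfolded L_def])
qed

lemma conformal_submodule_iff: "conformal_submodule sM act N \<longleftrightarrow> O.invariant N"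
  unfolding conformal_submodule_def O.invariant_def
  using coeff_act_mem[of N] by (auto simp: L_def)

lemma act_eq_0:
  assumes "\<And>x j. L x j m = 0" shows "act a m = 0"
  using coeff_act_mem[of "{0}" m a] assms by (intro poly_eqI) simp

lemma ex_nontrivial_irreducible_submodule:
  assumes "finite_module sM" "free_module sM" "\<not> trivial_on act UNIV"
  shows "\<exists>N. irreducible_submodule sM act N \<and> \<not> trivial_on act N"
proof -
  obtain x j m where "L x j m \<noteq> 0"
    using assms(3) act_eq_0 unfolding trivial_on_def by blast
  from O.ex_irreducible[OF assms(1) O.torsion_free_free_module[OF assms(2)] this]
  obtain N n where N: "O.invariant N"
    "\<And>N'. O.invariant N' \<Longrightarrow> N' \<subseteq> N \<Longrightarrow> N' = {0} \<or> N' = N" "n \<in> N" "L 1 0 n \<noteq> 0" by blast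
  then have "act [:1:] n \<noteq> 0" by (auto simp: L_def)
  with N show ?thesis
    unfolding irreducible_submodule_def conformal_submodule_iff trivial_on_def by blast
qed

lemma finite_dim_of_faithful_module:
  assumes "finite_module sM" "faithful act"
  shows "\<exists>B. finite B \<and> A.span B = UNIV"
proof (rule O.finite_dim_of_faithful[OF assms(1)])
  fix x assume x: "\<And>j m. L x j m = 0"
  have "act [:x:] m = 0" for m using x by (intro poly_eqI) (simp add: L_def)
  then have "[:x:] = 0" using assms(2) unfolding faithful_def by blast
  then show "x = 0" by simp
qed

end

theorem proposition3p7:
  fixes sc :: "complex \<Rightarrow> 'a::{comm_ring, comm_monoid_mult} \<Rightarrow> 'a"
  assumes "unital_comm_algebra sc"
  shows "artinian (map_vir_scale sc) (map_vir_bracket sc) TYPE('m::ab_group_add) \<and>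
    (\<not> (\<exists>B. finite B \<and> module.span sc B = UNIV) \<longrightarrow>
      \<not> (\<exists>(sM :: complex poly \<Rightarrow> 'n::ab_group_add \<Rightarrow> 'n) act.
           conformal_module (map_vir_scale sc) (map_vir_bracket sc) sM act \<and>
           finite_module sM \<and> faithful act))"
proof -
  note intro = map_vir_conformal_module.intro[OF assms]
  show ?thesis
    unfolding artinian_def
    using map_vir_conformal_module.ex_nontrivial_irreducible_submodule[OF intro]
      map_vir_conformal_module.finite_dim_of_faithful_module[OF intro]
    by blast
qed

end
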